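(* Let $(X_t)_{t\in\Delta}$ be the Kuranishi family of the Iwasawa manifold $X_0$, let $\omega_t=i\alpha_t\wedge\bar\alpha_t+i\beta_t\wedge\bar\beta_t+i\gamma_t\wedge\bar\gamma_t$, viewed as a real $2$-form on the $C^\infty$ manifold underlying the fibres, and let $\omega_t^{1,1}$ be its component of bidegree $(1,1)$ with respect to the complex structure $J_0$ of $X_0$. Then the $J_0$-$(1,1)$-form $\omega_t^{1,1}$ is a Gauduchon metric on $X_0$ for every $t\in\Delta$ sufficiently close to $0$. Moreover, $\omega_0^{1,1}=\omega_0$ and $\omega_t^{1,1}$ varies in a $C^\infty$ way with $t$.
   Context: Iwasawa manifold: $X_0=G/\Gamma$, $G$ the Heisenberg group of upper unitriangular complex $3\times3$ matrices $\begin{pmatrix}1&z_1&z_3\\0&1&z_2\\0&0&1\end{pmatrix}$, $\Gamma\subset G$ the subgroup with entries in $\mathbb Z[i]$. $\alpha,\beta,\gamma$ are the holomorphic $1$-forms on $X_0$ induced by $dz_1,dz_2,dz_3-z_1dz_2$; $d\alpha=d\beta=0$, $d\gamma=-\alpha\wedge\beta$. $\xi_\alpha,\xi_\beta,\xi_\gamma$ is the dual frame of holomorphic vector fields. Deformations: $H^{0,1}(X_0,T^{1,0}X_0)$ has basis $\bar\alpha_\lambda\otimes\xi_i$ ($\alpha_1=\alpha,\alpha_2=\beta$, $\xi_1=\xi_\alpha,\xi_2=\xi_\beta,\xi_3=\xi_\gamma$; $\lambda=1,2$, $i=1,2,3$), with coordinates $t_{i\lambda}$. The Kuranishi family $(X_t)_{t\in\Delta}$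 is unobstructed and $\Delta$ is a small open ball about $0$ in this space. All $X_t$ have the same underlying $C^\infty$ manifold; with $D(t)=t_{11}t_{22}-t_{12}t_{21}$, the complex structure of $X_t$ has the $(1,0)$-coframe $\alpha_t=\alpha+t_{11}\bar\alpha+t_{12}\bar\beta$, $\beta_t=\beta+t_{21}\bar\alpha+t_{22}\bar\beta$, $\gamma_t=\gamma+t_{31}\bar\alpha+t_{32}\bar\beta-D(t)\bar\gamma$. A Hermitian metric is a positive definite $C^\infty$ $(1,1)$-form $\omega$; on an $n$-dimensional compact complex manifold it is Gauduchon if $\partial\bar\partial\omega^{n-1}=0$. *)

theory Defs
  imports "HOL-Analysis.Analysis" "HOL-Combinatorics.Permutations"
begin

section \<open>Smooth maps\<close>

text \<open>\<open>C^k\<close> and \<open>C^\<infinity>\<close> maps on an open set, by iterated directional derivatives.\<close>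

primrec Ck_on :: "nat \<Rightarrow> ('a::real_normed_vector \<Rightarrow> 'b::real_normed_vector) \<Rightarrow> 'a set \<Rightarrow> bool" where
  "Ck_on 0 f S = continuous_on S f"
| "Ck_on (Suc k) f S =
     ((\<forall>x\<in>S. f differentiable (at x)) \<and>
      (\<forall>v. Ck_on k (\<lambda>x. frechet_derivative f (at x) v) S))"

definition smooth_on :: "('a::real_normed_vector \<Rightarrow> 'b::real_normed_vector) \<Rightarrow> 'a set \<Rightarrow> bool" where
  "smooth_on f S \<longleftrightarrow> (\<forall>k. Ck_on k f S)"


section \<open>Complex-valued differential forms on \<open>\<complex>\<^sup>n\<close>, regarded as a real manifold\<close>

text \<open>All tangent spaces are identified with \<open>\<complex>\<^sup>n\<close>. A \<open>k\<close>-form evaluated at the point \<open>p\<close> takes a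
  sequence of tangent vectors, of which only \<open>v 0, \<dots>, v (k - 1)\<close> matter; see \<open>diff_form\<close>. Since the
  degree cannot be read off from such a function, the operations below carry it as an argument.\<close>

type_synonym 'n form = "complex^'n \<Rightarrow> (nat \<Rightarrow> complex^'n) \<Rightarrow> complex"

definition diff_form :: "nat \<Rightarrow> 'n::finite form \<Rightarrow> bool" where
  "diff_form k \<omega> \<longleftrightarrow>
     (\<forall>p v w. (\<forall>i<k. v i = w i) \<longrightarrow> \<omega> p v = \<omega> p w) \<and>
     (\<forall>p v. \<forall>i<k. linear (\<lambda>x. \<omega> p (v(i := x)))) \<and>
     (\<forall>p v i j. i < j \<and> j < k \<and> v i = v j \<longrightarrow> \<omega> p v = 0) \<and>
     (\<forall>v. smooth_on (\<lambda>p. \<omega> p v) UNIV)"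

text \<open>Convention: \<open>(\<alpha> \<and> \<beta>)(u, v) = \<alpha>(u) \<beta>(v) - \<alpha>(v) \<beta>(u)\<close> for 1-forms.\<close>

definition wedge :: "nat \<Rightarrow> nat \<Rightarrow> 'n::finite form \<Rightarrow> 'n form \<Rightarrow> 'n form" where
  "wedge k l \<eta> \<theta> p v =
     (\<Sum>\<sigma> | \<sigma> permutes {..<k+l}.
        of_int (sign \<sigma>) * \<eta> p (\<lambda>i. v (\<sigma> i)) * \<theta> p (\<lambda>i. v (\<sigma> (k + i)))) / (fact k * fact l)"

primrec wedge_power :: "nat \<Rightarrow> 'n::finite form \<Rightarrow> nat \<Rightarrow> 'n form" where
  "wedge_power k \<omega> 0 = (\<lambda>p v. 1)"
| "wedge_power k \<omega> (Suc m) = wedge k (k * m) \<omega> (wedge_power k \<omega> m)"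

definition cnj_form :: "'n::finite form \<Rightarrow> 'n form" where
  "cnj_form \<omega> p v = cnj (\<omega> p v)"

text \<open>The usual formula for \<open>(d\<omega>)(v\<^sub>0, \<dots>, v\<^sub>k)\<close> with the \<open>v\<^sub>i\<close> extended to constant vector fields, so
  that no brackets occur. The inner argument is the sequence \<open>v\<close> with \<open>v\<^sub>i\<close> left out.\<close>

definition ext_deriv :: "nat \<Rightarrow> 'n::finite form \<Rightarrow> 'n form" where
  "ext_deriv k \<omega> p v =
     (\<Sum>i\<le>k. (-1) ^ i *
        frechet_derivative (\<lambda>q. \<omega> q (\<lambda>j. v (if j < i then j else Suc j))) (at p) (v i))"

definition pullback :: "(complex^'n \<Rightarrow> complex^'m) \<Rightarrow> 'm::finite form \<Rightarrow> 'n::finite form" where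
  "pullback f \<omega> p v = \<omega> (f p) (\<lambda>i. frechet_derivative f (at p) (v i))"


section \<open>Complex structures and bidegrees\<close>

type_synonym 'n acs = "complex^'n \<Rightarrow> complex^'n \<Rightarrow> complex^'n"

definition almost_complex :: "'n::finite acs \<Rightarrow> bool" where
  "almost_complex J \<longleftrightarrow> (\<forall>p. linear (J p) \<and> (\<forall>v. J p (J p v) = - v))"

text \<open>The component of bidegree \<open>(p, q)\<close> of a \<open>(p + q)\<close>-form. A tangent vector \<open>v\<close> is the sum of
  its \<open>(1,0)\<close>-part \<open>(v - i Jv) / 2\<close> and its \<open>(0,1)\<close>-part \<open>(v + i Jv) / 2\<close>. Extend \<open>\<omega>\<close> to the
  complexified tangent space by \<open>\<complex>\<close>-multilinearity, insert \<open>(1,0)\<close>-parts in the slots in \<open>S\<close> and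
  \<open>(0,1)\<close>-parts in the others, and sum over all \<open>S\<close> with \<open>p\<close> elements. The inner sum over \<open>T\<close>
  expands this multilinearly, \<open>T\<close> being the set of slots where the term with \<open>Jv\<close> is chosen.\<close>

definition bidegree_part :: "'n::finite acs \<Rightarrow> nat \<Rightarrow> nat \<Rightarrow> 'n form \<Rightarrow> 'n form" where
  "bidegree_part J p q \<omega> x v =
     (\<Sum>S | S \<subseteq> {..<p+q} \<and> card S = p.
        (\<Sum>T\<in>Pow {..<p+q}.
           (\<Prod>j\<in>T. if j \<in> S then - \<i> else \<i>) *
           \<omega> x (\<lambda>j. if j \<in> T then J x (v j) else v j)) / 2 ^ (p + q))"

definition has_bidegree :: "'n::finite acs \<Rightarrow> nat \<Rightarrow> nat \<Rightarrow> 'n form \<Rightarrow> bool" where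
  "has_bidegree J p q \<omega> \<longleftrightarrow> bidegree_part J p q \<omega> = \<omega>"

text \<open>\<open>\<partial>\<close> and its conjugate on \<open>k\<close>-forms: on forms of bidegree \<open>(p, q)\<close> they are the components of
  \<open>d\<close> of bidegree \<open>(p + 1, q)\<close> and \<open>(p, q + 1)\<close>.\<close>

definition del :: "'n::finite acs \<Rightarrow> nat \<Rightarrow> 'n form \<Rightarrow> 'n form" where
  "del J k \<omega> x v =
     (\<Sum>p\<le>k. bidegree_part J (Suc p) (k - p) (ext_deriv k (bidegree_part J p (k - p) \<omega>)) x v)"

definition delbar :: "'n::finite acs \<Rightarrow> nat \<Rightarrow> 'n form \<Rightarrow> 'n form" where
  "delbar J k \<omega> x v =
     (\<Sum>p\<le>k. bidegree_part J p (Suc (k - p)) (ext_deriv k (bidegree_part J p (k - p) \<omega>)) x v)"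

text \<open>\<open>\<theta>\<^sub>1, \<theta>\<^sub>2, \<theta>\<^sub>3\<close> are of type \<open>(1,0)\<close> and form, at each point, a basis of the complex vector space
  of \<open>(1,0)\<close>-covectors of \<open>J\<close>.\<close>

definition coframe10 :: "3 acs \<Rightarrow> 3 form \<Rightarrow> 3 form \<Rightarrow> 3 form \<Rightarrow> bool" where
  "coframe10 J \<theta>\<^sub>1 \<theta>\<^sub>2 \<theta>\<^sub>3 \<longleftrightarrow>
     (\<forall>\<theta>\<in>{\<theta>\<^sub>1, \<theta>\<^sub>2, \<theta>\<^sub>3}. diff_form 1 \<theta> \<and> has_bidegree J 1 0 \<theta>) \<and>
     (\<forall>p l. linear l \<and> (\<forall>u. l (J p u) = \<i> * l u) \<longrightarrow>
        (\<exists>!c::complex^3. \<forall>u. l u = c$1 * \<theta>\<^sub>1 p (\<lambda>_. u) + c$2 * \<theta>\<^sub>2 p (\<lambda>_. u) + c$3 * \<theta>\<^sub>3 p (\<lambda>_. u)))"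


section \<open>The Iwasawa manifold\<close>

text \<open>\<open>heis\<close> is the global holomorphic chart \<open>(z\<^sub>1, z\<^sub>2, z\<^sub>3)\<close> of the Heisenberg group \<open>G\<close>, which
  identifies \<open>G\<close> with \<open>\<complex>\<^sup>3\<close>.\<close>

definition heis :: "complex^3 \<Rightarrow> complex^3^3" where
  "heis z = vector [vector [1, z$1, z$3], vector [0, 1, z$2], vector [0, 0, 1]]"

definition heis_coords :: "complex^3^3 \<Rightarrow> complex^3" where
  "heis_coords M = vector [M$1$2, M$2$3, M$1$3]"

definition gaussian_integers :: "complex set" where
  "gaussian_integers = {z. Re z \<in> \<int> \<and> Im z \<in> \<int>}"

definition heis_lattice :: "(complex^3^3) set" where
  "heis_lattice = {g \<in> range heis. \<forall>i j. g$i$j \<in> gaussian_integers}"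

definition left_translation :: "complex^3^3 \<Rightarrow> complex^3 \<Rightarrow> complex^3" where
  "left_translation g z = heis_coords (g ** heis z)"

text \<open>The \<open>C\<^sup>\<infinity>\<close> \<open>k\<close>-forms on the Iwasawa manifold \<open>X\<^sub>0\<close>, as forms on its universal cover \<open>G\<close>
  invariant under the deck group \<open>\<Gamma>\<close>. The action is by left translations, under which
  \<open>dz\<^sub>3 - z\<^sub>1 dz\<^sub>2\<close> is invariant.\<close>

definition iwasawa_form :: "nat \<Rightarrow> 3 form \<Rightarrow> bool" where
  "iwasawa_form k \<omega> \<longleftrightarrow>
     diff_form k \<omega> \<and> (\<forall>g\<in>heis_lattice. pullback (left_translation g) \<omega> = \<omega>)"

definition iwasawa_J :: "3 acs" where
  "iwasawa_J p v = \<i> *s v"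

definition iw_alpha :: "3 form" where "iw_alpha p v = v 0 $ 1"
definition iw_beta :: "3 form" where "iw_beta p v = v 0 $ 2"
definition iw_gamma :: "3 form" where "iw_gamma p v = v 0 $ 3 - p $ 1 * v 0 $ 2"


section \<open>Gauduchon metrics\<close>

text \<open>\<open>J\<close> is a complex structure on the \<open>C\<^sup>\<infinity>\<close> manifold underlying \<open>X\<^sub>0\<close>. Positivity
  is normalised so that \<open>i dz \<and> d\<bar>z\<close> is positive.\<close>

definition hermitian_metric :: "3 acs \<Rightarrow> 3 form \<Rightarrow> bool" where
  "hermitian_metric J \<omega> \<longleftrightarrow>
     iwasawa_form 2 \<omega> \<and> has_bidegree J 1 1 \<omega> \<and> (\<forall>p v. \<omega> p v \<in> \<real>) \<and>
     (\<forall>p u. u \<noteq> 0 \<longrightarrow> Re (\<omega> p (\<lambda>i. if i = 0 then u else J p u)) > 0)"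

definition gauduchon_metric :: "3 acs \<Rightarrow> 3 form \<Rightarrow> bool" where
  "gauduchon_metric J \<omega> \<longleftrightarrow>
     hermitian_metric J \<omega> \<and>
     (let n = CARD(3) in
       del J (2 * (n - 1) + 1) (delbar J (2 * (n - 1)) (wedge_power 2 \<omega> (n - 1))) = (\<lambda>p v. 0))"


section \<open>The Kuranishi family of the Iwasawa manifold\<close>

text \<open>The component \<open>t $ i $ \<lambda>\<close> of a parameter is the coordinate \<open>t\<^sub>i\<^sub>\<lambda>\<close>.\<close>

definition kur_D :: "complex^2^3 \<Rightarrow> complex" where
  "kur_D t = t$1$1 * t$2$2 - t$1$2 * t$2$1"

definition kur_alpha :: "complex^2^3 \<Rightarrow> 3 form" where
  "kur_alpha t p v = iw_alpha p v + t$1$1 * cnj_form iw_alpha p v + t$1$2 * cnj_form iw_beta p v"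

definition kur_beta :: "complex^2^3 \<Rightarrow> 3 form" where
  "kur_beta t p v = iw_beta p v + t$2$1 * cnj_form iw_alpha p v + t$2$2 * cnj_form iw_beta p v"

definition kur_gamma :: "complex^2^3 \<Rightarrow> 3 form" where
  "kur_gamma t p v =
     iw_gamma p v + t$3$1 * cnj_form iw_alpha p v + t$3$2 * cnj_form iw_beta p v
       - kur_D t * cnj_form iw_gamma p v"

text \<open>\<open>J t\<close> is the complex structure of the fibre \<open>X\<^sub>t\<close>, read on the common universal cover. On \<open>\<Delta>\<close> it
  is determined by the coframe condition, which also makes it smooth, \<open>\<Gamma>\<close>-invariant and integrable
  (\<open>d\<alpha>\<^sub>t = d\<beta>\<^sub>t = 0\<close>, and \<open>d\<gamma>\<^sub>t\<close> lies in the ideal generated by \<open>\<alpha>\<^sub>t\<close> and \<open>\<beta>\<^sub>t\<close>). The condition can be met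
  exactly when \<open>\<Delta>\<close> is so small that \<open>\<alpha>\<^sub>t, \<beta>\<^sub>t, \<gamma>\<^sub>t\<close> and their conjugates form a frame for all
  \<open>t\<close> in \<open>\<Delta>\<close>. The clause on \<open>J 0\<close> follows from it as well and only names the central fibre.\<close>

definition iwasawa_kuranishi_family :: "(complex^2^3) set \<Rightarrow> (complex^2^3 \<Rightarrow> 3 acs) \<Rightarrow> bool" where
  "iwasawa_kuranishi_family \<Delta> J \<longleftrightarrow>
     (\<exists>r>0. \<Delta> = ball 0 r) \<and>
     J 0 = iwasawa_J \<and>
     (\<forall>t\<in>\<Delta>. almost_complex (J t) \<and> coframe10 (J t) (kur_alpha t) (kur_beta t) (kur_gamma t))"

definition kur_omega :: "complex^2^3 \<Rightarrow> 3 form" where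
  "kur_omega t p v =
     \<i> * wedge 1 1 (kur_alpha t) (cnj_form (kur_alpha t)) p v +
     \<i> * wedge 1 1 (kur_beta t) (cnj_form (kur_beta t)) p v +
     \<i> * wedge 1 1 (kur_gamma t) (cnj_form (kur_gamma t)) p v"

text \<open>Smooth dependence on a parameter means joint smoothness in the parameter and the point.\<close>

definition smooth_family_on :: "('t::real_normed_vector) set \<Rightarrow> ('t \<Rightarrow> 'n::finite form) \<Rightarrow> bool" where
  "smooth_family_on \<Delta> \<omega> \<longleftrightarrow> (\<forall>v. smooth_on (\<lambda>(t, p). \<omega> t p v) (\<Delta> \<times> UNIV))"

end

theory Submission
  imports Defs
begin

text \<open>The form \<open>\<omega>\<^sub>t\<close> and its \<open>(1,1)\<close>-part are invariant under left translations of the Heisenberg group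
  \<open>G\<close>, and invariance is preserved by \<open>\<and>\<close>, \<open>d\<close> and by taking components of a given bidegree with
  respect to \<open>J\<^sub>0\<close>. Since \<open>G\<close> is unimodular, invariant forms of degree \<open>5 = dim G - 1\<close> are closed. Hence
  \<open>\<partial>\<close> vanishes on the invariant \<open>5\<close>-form obtained by applying the conjugate of \<open>\<partial>\<close> to the square of the
  metric.

  Writing \<open>\<alpha>\<^sub>t = a + b\<close> with \<open>a = \<alpha>\<close> of type \<open>(1,0)\<close> and \<open>b\<close> of type \<open>(0,1)\<close>, and similarly for \<open>\<beta>\<^sub>t\<close> and \<open>\<gamma>\<^sub>t\<close>,
  the Hermitian quadratic form of the \<open>(1,1)\<close>-part is a sum of three terms \<open>2 (|a|\<^sup>2 - |b|\<^sup>2)\<close>, which is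
  positive definite as long as \<open>t\<close> is small.\<close>

section \<open>Alternating forms\<close>

text \<open>The algebraic half of \<open>diff_form\<close>, isolated so that multilinear algebra can
  be done on a single tangent space.\<close>

definition alt_form :: "nat \<Rightarrow> ((nat \<Rightarrow> 'a::real_vector) \<Rightarrow> complex) \<Rightarrow> bool" where
  "alt_form k f \<longleftrightarrow>
     (\<forall>v w. (\<forall>i<k. v i = w i) \<longrightarrow> f v = f w) \<and>
     (\<forall>v. \<forall>i<k. linear (\<lambda>x. f (v(i := x)))) \<and>
     (\<forall>v i j. i < j \<and> j < k \<and> v i = v j \<longrightarrow> f v = 0)"

lemma diff_form_iff_alt_form:
  "diff_form k \<omega> \<longleftrightarrow> (\<forall>p. alt_form k (\<omega> p)) \<and> (\<forall>v. smooth_on (\<lambda>p. \<omega> p v) UNIV)"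
  unfolding diff_form_def alt_form_def by blast

lemma alt_form_cong: "alt_form k f \<Longrightarrow> (\<And>i. i < k \<Longrightarrow> v i = w i) \<Longrightarrow> f v = f w"
  unfolding alt_form_def by blast

lemma alt_form_linear: "alt_form k f \<Longrightarrow> i < k \<Longrightarrow> linear (\<lambda>x. f (v(i := x)))"
  unfolding alt_form_def by blast

lemma alt_form_eq_0: "alt_form k f \<Longrightarrow> i < k \<Longrightarrow> j < k \<Longrightarrow> i \<noteq> j \<Longrightarrow> v i = v j \<Longrightarrow> f v = 0"
  unfolding alt_form_def by (metis linorder_neqE_nat)

lemma alt_formI:
  assumes "\<And>v w. (\<And>i. i < k \<Longrightarrow> v i = w i) \<Longrightarrow> f v = f w"
    and "\<And>v i. i < k \<Longrightarrow> linear (\<lambda>x. f (v(i := x)))"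
    and "\<And>v i j. i < j \<Longrightarrow> j < k \<Longrightarrow> v i = v j \<Longrightarrow> f v = 0"
  shows "alt_form k f"
  using assms unfolding alt_form_def by blast

text \<open>Polarisation: expand \<open>f\<close> with \<open>x + y\<close> in both slots. Vanishing
  is assumed for one pair of slots only, so the lemma applies before full alternation is
  known.\<close>

lemma multilinear_transpose:
  fixes f :: "(nat \<Rightarrow> 'a::real_vector) \<Rightarrow> complex"
  assumes lin: "\<And>v i. i < k \<Longrightarrow> linear (\<lambda>x. f (v(i := x)))"
    and alt: "\<And>v. v i = v j \<Longrightarrow> f v = 0"
    and ij: "i < k" "j < k" "i \<noteq> j"
  shows "f (v(i := y, j := x)) = - f (v(i := x, j := y))"
proof -
  have add_i: "f (v(i := a + b, j := c)) = f (v(i := a, j := c)) + f (v(i := b, j := c))" for a b c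
    using linear_add[OF lin[OF ij(1), of "v(j := c)"], of a b] ij(3) by (simp add: fun_upd_twist)
  have add_j: "f (v(i := c, j := a + b)) = f (v(i := c, j := a)) + f (v(i := c, j := b))" for a b c
    using linear_add[OF lin[OF ij(2), of "v(i := c)"], of a b] by simp
  have "f (v(i := a, j := a)) = 0" for a
    using ij(3) by (intro alt) auto
  from this[of "x + y"] this[of x] this[of y] show ?thesis
    by (simp add: add_i add_j eq_neg_iff_add_eq_0 add.commute)
qed

lemma comp_transpose_eq_fun_upd:
  "v \<circ> Transposition.transpose i j = v(i := v j, j := v i)"
  by (auto simp: fun_eq_iff Transposition.transpose_def)

lemma alt_form_transpose:
  assumes "alt_form k f" "i < k" "j < k" "i \<noteq> j"
  shows "f (v \<circ> Transposition.transpose i j) = - f v"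
proof -
  have "f (v(i := v j, j := v i)) = - f (v(i := v i, j := v j))"
    using assms by (intro multilinear_transpose[where k = k] alt_form_linear alt_form_eq_0)
  then show ?thesis by (simp add: comp_transpose_eq_fun_upd)
qed

text \<open>Induction on the gap between the equal arguments: swapping the later one with its left
  neighbour costs a sign and shortens the gap. This form of the criterion suits exterior
  derivatives, where the terms omitting neighbouring arguments cancel.\<close>

lemma alt_formI_adjacent:
  assumes cong: "\<And>v w. (\<And>i. i < k \<Longrightarrow> v i = w i) \<Longrightarrow> f v = f w"
    and lin: "\<And>v i. i < k \<Longrightarrow> linear (\<lambda>x. f (v(i := x)))"
    and adj: "\<And>v i. Suc i < k \<Longrightarrow> v i = v (Suc i) \<Longrightarrow> f v = 0"
  shows "alt_form k f"
proof (rule alt_formI[OF cong lin])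
  have gap: "f v = 0" if "i + Suc n < k" "v i = v (i + Suc n)" for n v i
    using that
  proof (induction n arbitrary: v)
    case 0
    then show ?case using adj[of i v] by simp
  next
    case (Suc n)
    let ?j = "i + Suc n"
    have swap: "f (v(?j := v (Suc ?j), Suc ?j := v ?j)) = - f (v(?j := v ?j, Suc ?j := v (Suc ?j)))"
      using Suc.prems by (intro multilinear_transpose[where k = k] lin adj) auto
    have "f (v(?j := v (Suc ?j), Suc ?j := v ?j)) = 0"
      using Suc.prems by (intro Suc.IH) auto
    with swap show ?case by simp
  qed
  show "f v = 0" if "i < j" "j < k" "v i = v j" for v i j
    using gap[of i "j - Suc i" v] that by simp
qed

lemma alt_form_compose_linear:
  assumes f: "alt_form k f" and L: "linear L"
  shows "alt_form k (\<lambda>v. f (\<lambda>i. L (v i)))"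
proof (rule alt_formI)
  fix v i assume "i < k"
  moreover have "(\<lambda>j. L ((v(i := x)) j)) = (\<lambda>j. L (v j))(i := L x)" for x
    by auto
  ultimately show "linear (\<lambda>x. f (\<lambda>j. L ((v(i := x)) j)))"
    using linear_compose[OF L alt_form_linear[OF f, of i "\<lambda>j. L (v j)"]] by (simp add: o_def)
next
  show "f (\<lambda>i. L (v i)) = 0" if "i < j" "j < k" "v i = v j" for v i j
    using that by (intro alt_form_eq_0[OF f, of i j]) auto
qed (auto intro: alt_form_cong[OF f])

lemma alt_form_eq_0_if_Basis:
  fixes f :: "(nat \<Rightarrow> 'a::euclidean_space) \<Rightarrow> complex"
  assumes f: "alt_form k f"
    and Basis: "\<And>v. v ` {..<k} \<subseteq> Basis \<Longrightarrow> inj_on v {..<k} \<Longrightarrow> f v = 0"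
  shows "f v = 0"
proof -
  \<comment> \<open>\<open>m\<close> counts the leading slots that still hold arbitrary vectors;
    linearity in the last of these reduces it to basis vectors. Repeated basis vectors are excluded
    by alternation.\<close>
  have "f v = 0" if "\<forall>i<k. m \<le> i \<longrightarrow> v i \<in> Basis" "m \<le> k" for m v
    using that
  proof (induction m arbitrary: v)
    case 0
    show ?case
    proof (cases "inj_on v {..<k}")
      case True
      with 0 show ?thesis by (intro Basis) auto
    next
      case False
      then obtain i j where "i < k" "j < k" "i \<noteq> j" "v i = v j"
        by (auto simp: inj_on_def)
      then show ?thesis by (intro alt_form_eq_0[OF f])
    qed
  next
    case (Suc m)
    have "f (v(m := b)) = 0" if "b \<in> Basis" for b
      using that Suc.prems by (intro Suc.IH) (auto simp: Suc_le_eq)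
    then have "f (v(m := x)) = 0" for x
      using linear_eq_0_on_span[OF alt_form_linear[OF f, of m v], of Basis x] Suc.prems by auto
    from this[of "v m"] show ?case by simp
  qed
  from this[of k] show ?thesis by simp
qed

section \<open>Closure of alternating forms under sums, wedge products and bidegree
  components\<close>

lemma alt_form_sum:
  assumes "\<And>i. i \<in> I \<Longrightarrow> alt_form k (f i)"
  shows "alt_form k (\<lambda>v. \<Sum>i\<in>I. f i v)"
proof (rule alt_formI)
  show "(\<Sum>i\<in>I. f i v) = (\<Sum>i\<in>I. f i w)" if "\<And>i. i < k \<Longrightarrow> v i = w i" for v w
    using that by (intro sum.cong alt_form_cong[OF assms]) auto
  show "linear (\<lambda>x. \<Sum>i\<in>I. f i (v(j := x)))" if "j < k" for v j
    using that by (intro linear_compose_sum ballI alt_form_linear[OF assms])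
  show "(\<Sum>i\<in>I. f i v) = 0" if "i < j" "j < k" "v i = v j" for v i j
    using that by (intro sum.neutral ballI alt_form_eq_0[OF assms, of _ i j]) auto
qed

lemma linear_mult_const: "linear f \<Longrightarrow> linear (\<lambda>x. c * (f x :: complex))"
  unfolding linear_iff by (simp add: algebra_simps)

lemma linear_const_mult: "linear f \<Longrightarrow> linear (\<lambda>x. (f x :: complex) * c)"
  unfolding linear_iff by (simp add: algebra_simps)

lemma linear_divide_const: "linear f \<Longrightarrow> linear (\<lambda>x. (f x :: complex) / c)"
  unfolding linear_iff by (simp add: add_divide_distrib scaleR_conv_of_real)

text \<open>A wedge product is alternating whatever its factors are: composing the permutations with a
  transposition changes the sign of each term.\<close>

lemma alt_form_wedge:
  assumes \<eta>: "alt_form k (\<eta> p)" and \<theta>: "alt_form l (\<theta> p)"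
  shows "alt_form (k + l) (wedge k l \<eta> \<theta> p)"
proof (rule alt_formI)
  fix v w :: "nat \<Rightarrow> complex^'a" assume eq: "\<And>i. i < k + l \<Longrightarrow> v i = w i"
  have "\<eta> p (\<lambda>i. v (\<sigma> i)) = \<eta> p (\<lambda>i. w (\<sigma> i)) \<and>
        \<theta> p (\<lambda>i. v (\<sigma> (k + i))) = \<theta> p (\<lambda>i. w (\<sigma> (k + i)))"
    if "\<sigma> permutes {..<k+l}" for \<sigma>
    using permutes_in_image[OF that]
    by (intro conjI alt_form_cong[OF \<eta>] alt_form_cong[OF \<theta>] eq) auto
  then show "wedge k l \<eta> \<theta> p v = wedge k l \<eta> \<theta> p w"
    unfolding wedge_def by (intro arg_cong2[of _ _ _ _ "(/)"] sum.cong refl) auto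
next
  fix v :: "nat \<Rightarrow> complex^'a" and a assume a: "a < k + l"
  have "linear (\<lambda>x. of_int (sign \<sigma>) * \<eta> p (\<lambda>i. (v(a := x)) (\<sigma> i)) *
      \<theta> p (\<lambda>i. (v(a := x)) (\<sigma> (k + i))))"
    if \<sigma>: "\<sigma> permutes {..<k+l}" for \<sigma>
  proof -
    \<comment> \<open>\<open>b\<close> is the position at which the permuted argument list holds the
      varying vector; it belongs to the first factor exactly when \<open>b < k\<close>.\<close>
    obtain b where b: "\<sigma> b = a" "b < k + l"
      using permutes_surj[OF \<sigma>] permutes_in_image[OF \<sigma>] a by (metis lessThan_iff surjD)
    have "\<sigma> i = a \<longleftrightarrow> i = b" for i
      using inj_eq[OF permutes_inj[OF \<sigma>]] b by metis
    then have upd: "(v(a := x)) (\<sigma> i) = (if i = b then x else v (\<sigma> i))" for x i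
      by simp
    show ?thesis
    proof (cases "b < k")
      case True
      have "\<eta> p (\<lambda>i. (v(a := x)) (\<sigma> i)) = \<eta> p ((\<lambda>i. v (\<sigma> i))(b := x))" for x
        unfolding upd by (rule arg_cong[of _ _ "\<eta> p"]) auto
      moreover have "\<theta> p (\<lambda>i. (v(a := x)) (\<sigma> (k + i))) = \<theta> p (\<lambda>i. v (\<sigma> (k + i)))" for x
        using True unfolding upd by (intro arg_cong[of _ _ "\<theta> p"]) auto
      ultimately show ?thesis
        by (simp only:) (intro linear_const_mult linear_mult_const alt_form_linear[OF \<eta> True])
    next
      case False
      then have bk: "b - k < l" using b by auto
      have "\<eta> p (\<lambda>i. (v(a := x)) (\<sigma> i)) = \<eta> p (\<lambda>i. v (\<sigma> i))" for x
        using False unfolding upd by (intro alt_form_cong[OF \<eta>]) auto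
      moreover have "\<theta> p (\<lambda>i. (v(a := x)) (\<sigma> (k + i))) = \<theta> p ((\<lambda>i. v (\<sigma> (k + i)))(b - k := x))" for x
        using False unfolding upd by (intro arg_cong[of _ _ "\<theta> p"]) (auto simp: fun_eq_iff)
      ultimately show ?thesis
        by (simp only:) (intro linear_mult_const alt_form_linear[OF \<theta> bk])
    qed
  qed
  then show "linear (\<lambda>x. wedge k l \<eta> \<theta> p (v(a := x)))"
    unfolding wedge_def by (intro linear_divide_const linear_compose_sum) auto
next
  fix v :: "nat \<Rightarrow> complex^'a" and a b assume ab: "a < b" "b < k + l" "v a = v b"
  let ?\<tau> = "Transposition.transpose a b"
  let ?t = "\<lambda>\<sigma>. of_int (sign \<sigma>) * \<eta> p (\<lambda>i. v (\<sigma> i)) * \<theta> p (\<lambda>i. v (\<sigma> (k + i)))"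
  have \<tau>: "?\<tau> permutes {..<k+l}"
    using ab by (intro permutes_swap_id) auto
  have v\<tau>: "v (?\<tau> i) = v i" for i
    using ab by (auto simp: Transposition.transpose_def)
  have "?t (?\<tau> \<circ> \<sigma>) = - ?t \<sigma>" if "\<sigma> permutes {..<k+l}" for \<sigma>
  proof -
    have "sign (?\<tau> \<circ> \<sigma>) = - sign \<sigma>"
      using that \<tau> ab permutes_imp_permutation[OF finite_lessThan]
      by (subst sign_compose) (auto simp: sign_swap_id)
    then show ?thesis by (simp add: v\<tau>)
  qed
  then have "(\<Sum>\<sigma> | \<sigma> permutes {..<k+l}. ?t \<sigma>) = - (\<Sum>\<sigma> | \<sigma> permutes {..<k+l}. ?t \<sigma>)"
    by (subst setum_permutations_compose_left[OF \<tau>]) (simp flip: sum_negf)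
  then show "wedge k l \<eta> \<theta> p v = 0"
    unfolding wedge_def by simp
qed

text \<open>For alternation, the transposition of the two equal slots acts on \<open>S\<close> and
  \<open>T\<close> simultaneously. It permutes the summands, preserves their coefficients, and
  reverses the sign of the value of \<open>\<omega>\<close>, so the double sum equals its own
  negative.\<close>

lemma alt_form_bidegree_part:
  assumes \<omega>: "alt_form (p + q) (\<omega> x)" and J: "linear (J x)"
  shows "alt_form (p + q) (bidegree_part J p q \<omega> x)"
proof (rule alt_formI)
  fix v w :: "nat \<Rightarrow> complex^'a" assume "\<And>i. i < p + q \<Longrightarrow> v i = w i"
  then have "\<omega> x (\<lambda>j. if j \<in> T then J x (v j) else v j) = \<omega> x (\<lambda>j. if j \<in> T then J x (w j) else w j)" for T
    by (intro alt_form_cong[OF \<omega>]) auto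
  then show "bidegree_part J p q \<omega> x v = bidegree_part J p q \<omega> x w"
    unfolding bidegree_part_def by simp
next
  fix v :: "nat \<Rightarrow> complex^'a" and a assume a: "a < p + q"
  have "linear (\<lambda>y. \<omega> x (\<lambda>j. if j \<in> T then J x ((v(a := y)) j) else (v(a := y)) j))" for T
  proof -
    let ?u = "\<lambda>j. if j \<in> T then J x (v j) else v j"
    have eq: "(\<lambda>j. if j \<in> T then J x ((v(a := y)) j) else (v(a := y)) j) =
        ?u(a := (if a \<in> T then J x else id) y)" for y
      by auto
    have "linear (if a \<in> T then J x else id)"
      using J by (auto intro: linear_id)
    from linear_compose[OF this alt_form_linear[OF \<omega> a, of ?u]] show ?thesis
      unfolding eq o_def .
  qed
  then show "linear (\<lambda>y. bidegree_part J p q \<omega> x (v(a := y)))"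
    unfolding bidegree_part_def
    by (intro linear_divide_const linear_compose_sum ballI linear_mult_const)
next
  fix v :: "nat \<Rightarrow> complex^'a" and a b assume ab: "a < b" "b < p + q" "v a = v b"
  let ?\<tau> = "Transposition.transpose a b"
  let ?\<S> = "{S. S \<subseteq> {..<p+q} \<and> card S = p}" and ?\<T> = "Pow {..<p+q}"
  let ?t = "\<lambda>S T. (\<Prod>j\<in>T. if j \<in> S then - \<i> else \<i>) * \<omega> x (\<lambda>j. if j \<in> T then J x (v j) else v j)"
  have inv: "?\<tau> ` ?\<tau> ` S = S" for S :: "nat set"
    by (simp add: image_comp)
  have map_T: "?\<tau> ` T \<in> ?\<T>" if "T \<in> ?\<T>" for T
    using that ab by (auto simp: Transposition.transpose_def split: if_splits)
  have map_S: "?\<tau> ` S \<in> ?\<S>" if "S \<in> ?\<S>" for S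
    using that map_T[of S] by (simp add: card_image del: image_subset_iff)
  have mem: "j \<in> ?\<tau> ` S \<longleftrightarrow> ?\<tau> j \<in> S" for j S
    by (auto intro: rev_image_eqI[of "?\<tau> j"])
  have flip: "?t (?\<tau> ` S) (?\<tau> ` T) = - ?t S T" for S T
  proof -
    let ?u = "\<lambda>j. if j \<in> T then J x (v j) else v j"
    have "(\<lambda>j. if j \<in> ?\<tau> ` T then J x (v j) else v j) = ?u \<circ> ?\<tau>"
      using ab by (auto simp: fun_eq_iff mem Transposition.transpose_def)
    moreover have "\<omega> x (?u \<circ> ?\<tau>) = - \<omega> x ?u"
      using ab by (intro alt_form_transpose[OF \<omega>]) auto
    moreover have "(\<Prod>j\<in>?\<tau> ` T. if j \<in> ?\<tau> ` S then - \<i> else \<i>) = (\<Prod>j\<in>T. if j \<in> S then - \<i> else \<i>)"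
      by (subst prod.reindex) (auto simp: mem)
    ultimately show ?thesis by simp
  qed
  have "(\<Sum>S\<in>?\<S>. \<Sum>T\<in>?\<T>. ?t S T) = (\<Sum>S\<in>?\<S>. \<Sum>T\<in>?\<T>. ?t (?\<tau> ` S) (?\<tau> ` T))"
  proof -
    have "(\<Sum>S\<in>?\<S>. \<Sum>T\<in>?\<T>. ?t S T) = (\<Sum>S\<in>?\<S>. \<Sum>T\<in>?\<T>. ?t (?\<tau> ` S) T)"
      by (rule sum.reindex_bij_witness[of _ "image ?\<tau>" "image ?\<tau>"])
        (simp_all only: inv map_S)
    also have "\<dots> = (\<Sum>S\<in>?\<S>. \<Sum>T\<in>?\<T>. ?t (?\<tau> ` S) (?\<tau> ` T))"
      by (intro sum.cong refl sum.reindex_bij_witness[of _ "image ?\<tau>" "image ?\<tau>"])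
        (simp_all only: inv map_T)
    finally show ?thesis .
  qed
  also have "\<dots> = - (\<Sum>S\<in>?\<S>. \<Sum>T\<in>?\<T>. ?t S T)"
    unfolding flip by (simp add: sum_negf)
  finally have "(\<Sum>S\<in>?\<S>. \<Sum>T\<in>?\<T>. ?t S T) = 0" by simp
  then show "bidegree_part J p q \<omega> x v = 0"
    unfolding bidegree_part_def by (simp flip: sum_divide_distrib)
qed

section \<open>Smooth maps\<close>

lemma frechet_derivative_eq:
  "(f has_derivative f') (at x) \<Longrightarrow> frechet_derivative f (at x) v = f' v"
  using frechet_derivative_at by metis

text \<open>On an open set, equality of functions passes to derivatives, so functions may be
  replaced by formulas valid only on \<open>S\<close>.\<close>

lemma Ck_on_cong:
  assumes "open S" "Ck_on k f S" "\<And>x. x \<in> S \<Longrightarrow> f x = g x"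
  shows "Ck_on k g S"
  using assms(2,3)
proof (induction k arbitrary: f g)
  case 0
  then show ?case using continuous_on_cong[of S S f g] by simp
next
  case (Suc k)
  have der: "(g has_derivative frechet_derivative f (at x)) (at x)" if "x \<in> S" for x
  proof (rule has_derivative_transform_within_open[OF _ assms(1) that])
    show "(f has_derivative frechet_derivative f (at x)) (at x)"
      using Suc.prems(1) that frechet_derivative_works by auto
  qed (use Suc.prems(2) in auto)
  have "Ck_on k (\<lambda>x. frechet_derivative g (at x) v) S" for v
  proof (rule Suc.IH[of "\<lambda>x. frechet_derivative f (at x) v"])
    show "Ck_on k (\<lambda>x. frechet_derivative f (at x) v) S"
      using Suc.prems(1) by simp
  qed (simp add: frechet_derivative_eq[OF der])
  then show ?case using der by (auto simp: differentiable_def)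
qed

lemma Ck_on_SucI:
  assumes "open S" "\<And>x. x \<in> S \<Longrightarrow> (f has_derivative f' x) (at x)"
    and "\<And>v. Ck_on k (\<lambda>x. f' x v) S"
  shows "Ck_on (Suc k) f S"
proof -
  have "Ck_on k (\<lambda>x. frechet_derivative f (at x) v) S" for v
    using frechet_derivative_eq[OF assms(2)] by (intro Ck_on_cong[OF assms(1) assms(3)[of v]]) simp
  then show ?thesis using assms(2) by (auto simp: differentiable_def)
qed

lemma Ck_on_Suc_has_derivative:
  "Ck_on (Suc k) f S \<Longrightarrow> x \<in> S \<Longrightarrow> (f has_derivative frechet_derivative f (at x)) (at x)"
  by (simp add: frechet_derivative_works)

text \<open>Needed for the product rule, whose terms contain undifferentiated factors that must
  count as one order less smooth.\<close>

lemma Ck_on_SucD: "Ck_on (Suc k) f S \<Longrightarrow> Ck_on k f S"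
proof (induction k arbitrary: f)
  case 0
  then show ?case
    by (simp add: continuous_at_imp_continuous_on differentiable_imp_continuous_within)
next
  case (Suc k)
  have "Ck_on k (\<lambda>x. frechet_derivative f (at x) v) S" for v
    using Suc.prems by (intro Suc.IH) simp
  with Suc.prems show ?case by simp
qed

lemma Ck_on_const: "Ck_on k (\<lambda>x. c) S"
  by (induction k arbitrary: c) auto

lemma Ck_on_linear: "open S \<Longrightarrow> bounded_linear T \<Longrightarrow> Ck_on k T S"
proof (cases k)
  case (Suc n)
  assume "open S" "bounded_linear T"
  then show ?thesis unfolding Suc
    by (intro Ck_on_SucI[where f' = "\<lambda>_. T"] Ck_on_const bounded_linear_imp_has_derivative)
qed (auto intro: linear_continuous_on)

lemma Ck_on_bounded_linear:
  assumes "open S" "bounded_linear T" "Ck_on k f S"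
  shows "Ck_on k (\<lambda>x. T (f x)) S"
  using assms(3)
proof (induction k arbitrary: f)
  case 0
  then show ?case
    using bounded_linear.continuous_on[OF assms(2)] by auto
next
  case (Suc k)
  then show ?case
    by (intro Ck_on_SucI[OF assms(1), where f' = "\<lambda>x v. T (frechet_derivative f (at x) v)"]
        bounded_linear.has_derivative[OF assms(2)] Suc.IH Ck_on_Suc_has_derivative[of k]) auto
qed

lemma Ck_on_add:
  assumes "open S" "Ck_on k f S" "Ck_on k g S"
  shows "Ck_on k (\<lambda>x. f x + g x) S"
  using assms(2,3)
proof (induction k arbitrary: f g)
  case 0
  then show ?case by (simp add: continuous_on_add)
next
  case (Suc k)
  then show ?case
    by (intro Ck_on_SucI[OF assms(1),
          where f' = "\<lambda>x v. frechet_derivative f (at x) v + frechet_derivative g (at x) v"]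
        has_derivative_add Suc.IH Ck_on_Suc_has_derivative[of k]) auto
qed

lemma Ck_on_mult:
  fixes f g :: "'a::real_normed_vector \<Rightarrow> 'b::real_normed_algebra"
  assumes "open S" "Ck_on k f S" "Ck_on k g S"
  shows "Ck_on k (\<lambda>x. f x * g x) S"
  using assms(2,3)
proof (induction k arbitrary: f g)
  case 0
  then show ?case by (simp add: continuous_on_mult)
next
  case (Suc k)
  have "Ck_on k (\<lambda>x. f x * frechet_derivative g (at x) v + frechet_derivative f (at x) v * g x) S" for v
    using Suc.prems Ck_on_SucD[OF Suc.prems(1)] Ck_on_SucD[OF Suc.prems(2)]
    by (intro Ck_on_add[OF assms(1)] Suc.IH) auto
  with Suc.prems show ?case
    by (intro Ck_on_SucI[OF assms(1), where f' = "\<lambda>x v. f x * frechet_derivative g (at x) v +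
          frechet_derivative f (at x) v * g x"] has_derivative_mult Ck_on_Suc_has_derivative[of k])
qed

section \<open>Closure rules for smooth maps\<close>

named_theorems smooth_intros

lemma smooth_on_const [smooth_intros]: "smooth_on (\<lambda>x. c) S"
  by (simp add: smooth_on_def Ck_on_const)

lemma smooth_on_bounded_linear:
  "open S \<Longrightarrow> bounded_linear T \<Longrightarrow> smooth_on f S \<Longrightarrow> smooth_on (\<lambda>x. T (f x)) S"
  by (simp add: smooth_on_def Ck_on_bounded_linear)

lemma smooth_on_linear: "open S \<Longrightarrow> bounded_linear T \<Longrightarrow> smooth_on T S"
  by (simp add: smooth_on_def Ck_on_linear)

lemma smooth_on_add [smooth_intros]:
  "open S \<Longrightarrow> smooth_on f S \<Longrightarrow> smooth_on g S \<Longrightarrow> smooth_on (\<lambda>x. f x + g x) S"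
  by (simp add: smooth_on_def Ck_on_add)

lemma smooth_on_minus [smooth_intros]:
  "open S \<Longrightarrow> smooth_on f S \<Longrightarrow> smooth_on (\<lambda>x. - f x) S"
  by (rule smooth_on_bounded_linear[OF _ bounded_linear_minus[OF bounded_linear_ident]])

lemma smooth_on_diff [smooth_intros]:
  "open S \<Longrightarrow> smooth_on f S \<Longrightarrow> smooth_on g S \<Longrightarrow> smooth_on (\<lambda>x. f x - g x) S"
  using smooth_on_add[of S f "\<lambda>x. - g x"] smooth_on_minus[of S g] by simp

lemma smooth_on_mult [smooth_intros]:
  fixes f g :: "'a::real_normed_vector \<Rightarrow> 'b::real_normed_algebra"
  shows "open S \<Longrightarrow> smooth_on f S \<Longrightarrow> smooth_on g S \<Longrightarrow> smooth_on (\<lambda>x. f x * g x) S"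
  by (simp add: smooth_on_def Ck_on_mult)

lemma smooth_on_cnj [smooth_intros]:
  "open S \<Longrightarrow> smooth_on f S \<Longrightarrow> smooth_on (\<lambda>x. cnj (f x)) S"
  by (rule smooth_on_bounded_linear[OF _ bounded_linear_cnj])

section \<open>Exterior derivatives of left-invariant forms\<close>

text \<open>The product rule for a multilinear map: one summand for each moving argument.\<close>

lemma has_derivative_alt_form:
  fixes f :: "(nat \<Rightarrow> 'a::euclidean_space) \<Rightarrow> complex"
  assumes f: "alt_form k f" and g: "\<And>j. j < k \<Longrightarrow> (g j has_derivative g' j) (at x)"
  shows "((\<lambda>q. f (\<lambda>j. g j q)) has_derivative
    (\<lambda>h. \<Sum>j<k. f ((\<lambda>i. g i x)(j := g' j h)))) (at x)"
proof -
  \<comment> \<open>In \<open>G m c q\<close> the first \<open>m\<close> arguments move with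
    \<open>q\<close> and the others are frozen at \<open>c\<close>. The induction on
    \<open>m\<close> keeps \<open>c\<close> general because its slot \<open>m\<close> gets
    overwritten by basis vectors.\<close>
  define G where "G m c q = (\<lambda>j. if j < m then g j q else c j)" for m :: nat and c q
  have G: "((\<lambda>q. f (G m c q)) has_derivative (\<lambda>h. \<Sum>j<m. f ((G m c x)(j := g' j h)))) (at x)"
    if "m \<le> k" for m c
    using that
  proof (induction m arbitrary: c)
    case 0
    then show ?case by (simp add: G_def)
  next
    case (Suc m)
    then have m: "m < k" "m \<le> k" by auto
    \<comment> \<open>Expanding slot \<open>m\<close> in a basis leaves products of a scalar
      coordinate with a form having one moving argument fewer.\<close>
    have expand: "f (u(m := y)) = (\<Sum>b\<in>Basis. (y \<bullet> b) *\<^sub>R f (u(m := b)))" for u y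
    proof -
      have "f (u(m := \<Sum>b\<in>Basis. (y \<bullet> b) *\<^sub>R b)) = (\<Sum>b\<in>Basis. (y \<bullet> b) *\<^sub>R f (u(m := b)))"
        by (simp only: linear_sum[OF alt_form_linear[OF f m(1)]] linear_scale[OF alt_form_linear[OF f m(1)]])
      then show ?thesis by (simp add: euclidean_representation)
    qed
    have G_Suc: "G (Suc m) c q = (G m c q)(m := g m q)" for q
      by (auto simp: G_def fun_eq_iff less_Suc_eq)
    have G_upd: "(G m c q)(m := b) = G m (c(m := b)) q" for b q
      by (auto simp: G_def fun_eq_iff)
    have G_upd2: "((G m c x)(m := b))(j := z) = ((G m c x)(j := z))(m := b)" if "j < m" for b j z
      using that by (intro fun_upd_twist) auto
    have "((\<lambda>q. \<Sum>b\<in>Basis. (g m q \<bullet> b) *\<^sub>R f (G m (c(m := b)) q)) has_derivative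
        (\<lambda>h. \<Sum>b\<in>Basis. (g m x \<bullet> b) *\<^sub>R (\<Sum>j<m. f ((G m (c(m := b)) x)(j := g' j h)))
          + (g' m h \<bullet> b) *\<^sub>R f (G m (c(m := b)) x))) (at x)"
      by (intro has_derivative_sum has_derivative_scaleR has_derivative_inner_left g Suc.IH m)
    also have "(\<lambda>q. \<Sum>b\<in>Basis. (g m q \<bullet> b) *\<^sub>R f (G m (c(m := b)) q)) = (\<lambda>q. f (G (Suc m) c q))"
      by (rule ext) (simp only: G_Suc expand[of "G m c _" "g m _"] flip: G_upd)
    also have "(\<lambda>h. \<Sum>b\<in>Basis. (g m x \<bullet> b) *\<^sub>R (\<Sum>j<m. f ((G m (c(m := b)) x)(j := g' j h)))
          + (g' m h \<bullet> b) *\<^sub>R f (G m (c(m := b)) x)) =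
        (\<lambda>h. \<Sum>j<Suc m. f ((G (Suc m) c x)(j := g' j h)))"
    proof
      fix h
      have "f ((G (Suc m) c x)(j := g' j h)) =
          (\<Sum>b\<in>Basis. (g m x \<bullet> b) *\<^sub>R f ((G m (c(m := b)) x)(j := g' j h)))" if "j < m" for j
        using that by (subst G_Suc) (simp only: G_upd2 expand[of _ "g m x"] flip: G_upd)
      moreover have "f ((G (Suc m) c x)(m := g' m h)) =
          (\<Sum>b\<in>Basis. (g' m h \<bullet> b) *\<^sub>R f (G m (c(m := b)) x))"
        by (simp only: G_Suc fun_upd_upd expand[of "G m c x" "g' m h"] flip: G_upd)
      ultimately show "(\<Sum>b\<in>Basis. (g m x \<bullet> b) *\<^sub>R (\<Sum>j<m. f ((G m (c(m := b)) x)(j := g' j h)))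
          + (g' m h \<bullet> b) *\<^sub>R f (G m (c(m := b)) x)) = (\<Sum>j<Suc m. f ((G (Suc m) c x)(j := g' j h)))"
        by (simp add: sum.distrib scaleR_sum_right sum.swap[of _ "{..<m}"])
    qed
    finally show ?case .
  qed
  have Gk: "f (G k (\<lambda>j. g j x) q) = f (\<lambda>j. g j q)" for q
    by (intro alt_form_cong[OF f]) (simp add: G_def)
  have Gkx: "G k (\<lambda>j. g j x) x = (\<lambda>j. g j x)"
    by (simp add: G_def)
  show ?thesis
    using G[OF order_refl, of "\<lambda>j. g j x"] unfolding Gk Gkx .
qed

text \<open>The increasing enumeration of the indices other than \<open>i\<close>, as it occurs
  inside \<open>ext_deriv\<close>.\<close>

definition skip :: "nat \<Rightarrow> nat \<Rightarrow> nat" where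
  "skip i j = (if j < i then j else Suc j)"

text \<open>The formula for the exterior derivative of a left-invariant form on a Lie group in terms of
  its value \<open>f\<close> at the identity. Here \<open>B\<close> is a bilinear map whose antisymmetrisation is
  minus the Lie bracket; it is the derivative of the left trivialisation of the tangent bundle.\<close>

definition lie_d :: "('a \<Rightarrow> 'a \<Rightarrow> 'a) \<Rightarrow> nat \<Rightarrow> ((nat \<Rightarrow> 'a::real_vector) \<Rightarrow> complex) \<Rightarrow> (nat \<Rightarrow> 'a) \<Rightarrow> complex" where
  "lie_d B k f w =
     (\<Sum>i\<le>k. (-1) ^ i * (\<Sum>j<k. f ((\<lambda>m. w (skip i m))(j := B (w i) (w (skip i j))))))"

lemma alt_form_lie_d:
  assumes f: "alt_form k f" and B: "bilinear B"
  shows "alt_form (Suc k) (lie_d B k f)"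
proof (rule alt_formI_adjacent)
  fix v w :: "nat \<Rightarrow> 'a" assume eq: "\<And>i. i < Suc k \<Longrightarrow> v i = w i"
  then have "v (skip i m) = w (skip i m)" if "m < k" for i m
    using that by (simp add: skip_def)
  then show "lie_d B k f v = lie_d B k f w"
    unfolding lie_d_def using eq
    by (intro sum.cong arg_cong2[of _ _ _ _ "(*)"] refl alt_form_cong[OF f]) auto
next
  fix v :: "nat \<Rightarrow> 'a" and a assume a: "a < Suc k"
  have "linear (\<lambda>x. f ((\<lambda>m. (v(a := x)) (skip i m))(j := B ((v(a := x)) i) ((v(a := x)) (skip i j)))))"
    if ij: "i \<le> k" "j < k" for i j
  proof -
    have skip_ne: "skip i j \<noteq> i" for j by (simp add: skip_def)
    have skip_inj: "skip i j = skip i j' \<longleftrightarrow> j = j'" for j j' by (simp add: skip_def)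
    let ?u = "\<lambda>m. v (skip i m)"
    \<comment> \<open>The varying vector is the omitted one, the one fed into \<open>B\<close> as
      second argument, or one left untouched; linearity comes from \<open>B\<close> in the first two
      cases and from \<open>f\<close> in the third.\<close>
    consider "a = i" | "a = skip i j" | m where "a = skip i m" "m \<noteq> j" "m < k"
    proof -
      have "a = i \<or> (\<exists>m<k. a = skip i m)"
      proof (cases "a = i")
        case False
        with a ij have "a = skip i (if a < i then a else a - 1)" "(if a < i then a else a - 1) < k"
          by (auto simp: skip_def)
        then show ?thesis by blast
      qed simp
      then show ?thesis using that by metis
    qed
    then show ?thesis
    proof cases
      case 1
      have "(\<lambda>m. (v(a := x)) (skip i m))(j := B ((v(a := x)) i) ((v(a := x)) (skip i j))) =
          ?u(j := B x (v (skip i j)))" for x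
        using skip_ne 1 by (auto simp: fun_eq_iff)
      moreover have "linear (\<lambda>x. B x (v (skip i j)))"
        using B by (simp add: bilinear_def)
      ultimately show ?thesis
        using linear_compose[OF _ alt_form_linear[OF f \<open>j < k\<close>, of ?u]] by (simp only: o_def)
    next
      case 2
      have "(\<lambda>m. (v(a := x)) (skip i m))(j := B ((v(a := x)) i) ((v(a := x)) (skip i j))) =
          ?u(j := B (v i) x)" for x
        using skip_ne[of j] 2 skip_inj by (auto simp: fun_eq_iff)
      moreover have "linear (B (v i))"
        using B by (simp add: bilinear_def)
      ultimately show ?thesis
        using linear_compose[OF _ alt_form_linear[OF f \<open>j < k\<close>, of ?u]] by (simp only: o_def)
    next
      case 3
      have "(\<lambda>m. (v(a := x)) (skip i m))(j := B ((v(a := x)) i) ((v(a := x)) (skip i j))) =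
          (?u(j := B (v i) (v (skip i j))))(m := x)" for x
        using skip_ne[of m] 3 skip_inj by (auto simp: fun_eq_iff)
      then show ?thesis
        using alt_form_linear[OF f \<open>m < k\<close>] by (simp only:)
    qed
  qed
  then show "linear (\<lambda>x. lie_d B k f (v(a := x)))"
    unfolding lie_d_def by (intro linear_compose_sum ballI linear_mult_const) auto
next
  fix w :: "nat \<Rightarrow> 'a" and a assume a: "Suc a < Suc k" and eq: "w a = w (Suc a)"
  define I where "I i = (\<Sum>j<k. f ((\<lambda>m. w (skip i m))(j := B (w i) (w (skip i j)))))" for i
  have "I i = 0" if "i \<le> k" "i \<noteq> a" "i \<noteq> Suc a" for i
  proof -
    \<comment> \<open>The equal vectors \<open>w a\<close> and \<open>w (Suc a)\<close> occupy
      positions \<open>b\<close> and \<open>Suc b\<close> once index \<open>i\<close> is left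
      out.\<close>
    define b where "b = (if a < i then a else a - 1)"
    have b: "Suc b < k" and wb: "w (skip i b) = w (skip i (Suc b))"
      using that a eq by (auto simp: b_def skip_def)
    let ?F = "\<lambda>j. f ((\<lambda>m. w (skip i m))(j := B (w i) (w (skip i j))))"
    let ?c = "B (w i) (w (skip i b))"
    \<comment> \<open>For any other \<open>j\<close> the two equal vectors both survive, so
      alternation kills the term. The two remaining terms differ by a swap.\<close>
    have "I i = sum ?F {b, Suc b}"
      unfolding I_def using b wb
      by (intro sum.mono_neutral_right) (auto intro!: alt_form_eq_0[OF f, of b "Suc b"])
    also have "\<dots> = ?F b + ?F (Suc b)" by simp
    also have "?F (Suc b) = - ?F b"
    proof -
      have "(\<lambda>m. w (skip i m))(Suc b := B (w i) (w (skip i (Suc b)))) =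
          (\<lambda>m. w (skip i m))(b := B (w i) (w (skip i b))) \<circ> Transposition.transpose b (Suc b)"
        unfolding comp_transpose_eq_fun_upd using wb by (auto simp: fun_eq_iff)
      then show ?thesis using alt_form_transpose[OF f, of b "Suc b"] b by simp
    qed
    finally show ?thesis by (simp only: add.right_inverse)
  qed
  then have "lie_d B k f w = (\<Sum>i\<in>{a, Suc a}. (-1) ^ i * I i)"
    unfolding lie_d_def I_def using a by (intro sum.mono_neutral_right) auto
  \<comment> \<open>Omitting either of two equal neighbours leaves the same sequence, while the
    signs in \<open>lie_d\<close> are opposite.\<close>
  moreover have "I (Suc a) = I a"
  proof -
    have "w (skip (Suc a) m) = w (skip a m)" for m
      using eq by (auto simp: skip_def less_Suc_eq)
    then show ?thesis unfolding I_def using eq by simp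
  qed
  ultimately show "lie_d B k f w = 0" by simp
qed

section \<open>Left-invariant forms on the Heisenberg group\<close>

text \<open>One half of the Heisenberg bracket, read off from the term - z1 dz2 of \<gamma>; its
  antisymmetrisation is minus the bracket.\<close>

definition heis_struct :: "complex^3 \<Rightarrow> complex^3 \<Rightarrow> complex^3" where
  "heis_struct u w = - (u $ 1 * w $ 2) *s axis 3 1"

text \<open>The differential at \<open>p\<close> of the left translation that takes \<open>p\<close> to the identity.\<close>

definition heis_triv :: "complex^3 \<Rightarrow> complex^3 \<Rightarrow> complex^3" where
  "heis_triv p v = v + heis_struct p v"

lemma heis_struct_nth [simp]:
  "heis_struct u w $ 1 = 0" "heis_struct u w $ 2 = 0" "heis_struct u w $ 3 = - (u $ 1 * w $ 2)"
  by (simp_all add: heis_struct_def axis_def)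

lemma heis_triv_nth [simp]:
  "heis_triv p v $ 1 = v $ 1" "heis_triv p v $ 2 = v $ 2"
  "heis_triv p v $ 3 = v $ 3 - p $ 1 * v $ 2"
  by (simp_all add: heis_triv_def)

lemma bilinear_heis_struct: "bilinear heis_struct"
  unfolding bilinear_def linear_iff by (simp add: vec_eq_iff forall_3 algebra_simps)

lemma linear_heis_triv: "linear (heis_triv p)"
  unfolding linear_iff by (simp add: vec_eq_iff forall_3 algebra_simps)

lemma heis_triv_0 [simp]: "heis_triv 0 v = v"
  by (simp add: vec_eq_iff forall_3)

text \<open>The trivialisation alters only the central coordinate, which \<open>heis_struct\<close>
  ignores. This makes the derivative formula for invariant forms independent of the point.\<close>

lemma heis_struct_heis_triv: "heis_struct (heis_triv p u) (heis_triv p w) = heis_struct u w"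
  by (simp add: heis_struct_def)

section \<open>Compatibility of the trivialisation with the complex structure of X_0\<close>

lemma iwasawa_J_nth [simp]: "iwasawa_J p v $ j = \<i> * v $ j"
  by (simp add: iwasawa_J_def)

lemma iwasawa_J_iwasawa_J [simp]: "iwasawa_J p (iwasawa_J q v) = - v"
  by (simp add: vec_eq_iff)

lemma linear_iwasawa_J: "linear (iwasawa_J p)"
  unfolding linear_iff by (simp add: vec_eq_iff algebra_simps)

lemma heis_triv_iwasawa_J: "heis_triv p (iwasawa_J q v) = iwasawa_J 0 (heis_triv p v)"
  by (simp add: vec_eq_iff forall_3 algebra_simps)

text \<open>Invariance under all of G, encoded by moving every tangent space to the identity, which
  is \<open>0\<close> in the chart. Such a form amounts to one alternating form on one vector
  space.\<close>

definition left_inv_form :: "nat \<Rightarrow> 3 form \<Rightarrow> bool" where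
  "left_inv_form k \<omega> \<longleftrightarrow> alt_form k (\<omega> 0) \<and> (\<forall>p v. \<omega> p v = \<omega> 0 (\<lambda>i. heis_triv p (v i)))"

lemma left_inv_formD: "left_inv_form k \<omega> \<Longrightarrow> \<omega> p v = \<omega> 0 (\<lambda>i. heis_triv p (v i))"
  unfolding left_inv_form_def by blast

lemma alt_form_left_inv_form:
  assumes "left_inv_form k \<omega>"
  shows "alt_form k (\<omega> p)"
proof -
  have "\<omega> p = (\<lambda>v. \<omega> 0 (\<lambda>i. heis_triv p (v i)))"
    using left_inv_formD[OF assms] by blast
  then show ?thesis
    using assms alt_form_compose_linear[OF _ linear_heis_triv] unfolding left_inv_form_def by metis
qed

lemma left_inv_form_wedge:
  assumes \<eta>: "left_inv_form k \<eta>" and \<theta>: "left_inv_form l \<theta>"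
  shows "left_inv_form (k + l) (wedge k l \<eta> \<theta>)"
  unfolding left_inv_form_def
proof (intro conjI allI)
  show "wedge k l \<eta> \<theta> p v = wedge k l \<eta> \<theta> 0 (\<lambda>i. heis_triv p (v i))" for p v
    unfolding wedge_def left_inv_formD[OF \<eta>, of p] left_inv_formD[OF \<theta>, of p] ..
qed (intro alt_form_wedge alt_form_left_inv_form assms)

lemma left_inv_form_wedge_power:
  assumes "left_inv_form k \<omega>"
  shows "left_inv_form (k * m) (wedge_power k \<omega> m)"
proof (induction m)
  case 0
  show ?case by (simp add: left_inv_form_def alt_form_def)
next
  case (Suc m)
  then show ?case using left_inv_form_wedge[OF assms] by simp
qed

lemma left_inv_form_bidegree_part:
  assumes \<omega>: "left_inv_form (p + q) \<omega>"
  shows "left_inv_form (p + q) (bidegree_part iwasawa_J p q \<omega>)"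
  unfolding left_inv_form_def
proof (intro conjI allI)
  fix x v
  have "\<omega> x (\<lambda>j. if j \<in> T then iwasawa_J x (v j) else v j) =
      \<omega> 0 (\<lambda>j. if j \<in> T then iwasawa_J 0 (heis_triv x (v j)) else heis_triv x (v j))" for T
    by (subst left_inv_formD[OF \<omega>]) (simp add: if_distrib[of "heis_triv x"] heis_triv_iwasawa_J cong: if_cong)
  then show "bidegree_part iwasawa_J p q \<omega> x v =
      bidegree_part iwasawa_J p q \<omega> 0 (\<lambda>i. heis_triv x (v i))"
    unfolding bidegree_part_def by simp
qed (intro alt_form_bidegree_part alt_form_left_inv_form[OF \<omega>] linear_iwasawa_J)

lemma left_inv_form_sum:
  assumes "\<And>i. i \<in> I \<Longrightarrow> left_inv_form k (f i)"
  shows "left_inv_form k (\<lambda>p v. \<Sum>i\<in>I. f i p v)"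
  unfolding left_inv_form_def
proof (intro conjI allI)
  show "(\<Sum>i\<in>I. f i p v) = (\<Sum>i\<in>I. f i 0 (\<lambda>i. heis_triv p (v i)))" for p v
    by (intro sum.cong refl left_inv_formD[OF assms])
qed (intro alt_form_sum alt_form_left_inv_form[OF assms])

text \<open>The point enters an invariant form only through \<open>heis_triv q u\<close>, which is
  affine in \<open>q\<close> with derivative \<open>heis_struct h u\<close>; the multilinear product
  rule does the rest.\<close>

lemma ext_deriv_left_inv_form:
  assumes \<omega>: "left_inv_form k \<omega>"
  shows "ext_deriv k \<omega> p v = lie_d heis_struct k (\<omega> 0) (\<lambda>i. heis_triv p (v i))"
proof -
  have alt: "alt_form k (\<omega> 0)"
    using \<omega> by (simp add: left_inv_form_def)
  have der_triv: "((\<lambda>q. heis_triv q u) has_derivative (\<lambda>h. heis_struct h u)) (at p)" for u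
  proof -
    have "bounded_linear (\<lambda>h. heis_struct h u)"
      using bilinear_heis_struct by (simp add: bilinear_def linear_conv_bounded_linear)
    then have "((\<lambda>q. u + heis_struct q u) has_derivative (\<lambda>h. 0 + heis_struct h u)) (at p)"
      by (intro has_derivative_add has_derivative_const bounded_linear_imp_has_derivative)
    then show ?thesis by (simp add: heis_triv_def)
  qed
  have "frechet_derivative (\<lambda>q. \<omega> q u) (at p) h =
      (\<Sum>j<k. \<omega> 0 ((\<lambda>m. heis_triv p (u m))(j := heis_struct h (u j))))" for u h
    using has_derivative_alt_form[OF alt der_triv, of "\<lambda>j. u j"]
    by (simp only: left_inv_formD[OF \<omega>, of _ u] frechet_derivative_eq)
  then show ?thesis
    unfolding ext_deriv_def lie_d_def
    by (simp only: skip_def[symmetric] heis_struct_heis_triv)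
qed

lemma left_inv_form_ext_deriv:
  assumes "left_inv_form k \<omega>"
  shows "left_inv_form (Suc k) (ext_deriv k \<omega>)"
proof -
  have "ext_deriv k \<omega> 0 = lie_d heis_struct k (\<omega> 0)"
    by (rule ext) (simp add: ext_deriv_left_inv_form[OF assms])
  then show ?thesis
    using alt_form_lie_d[OF _ bilinear_heis_struct] assms
    by (simp add: left_inv_form_def ext_deriv_left_inv_form[OF assms])
qed

text \<open>This is unimodularity of the Heisenberg group. On a real basis, a bracket \<open>[w\<^sub>i, w\<^sub>j]\<close> is
  nonzero only if \<open>w\<^sub>i\<close>, \<open>w\<^sub>j\<close> are not central; it is then a combination of two of the remaining
  basis vectors, so that the form vanishes by alternation.\<close>

lemma ext_deriv_left_inv_5_form:
  assumes \<omega>: "left_inv_form 5 \<omega>"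
  shows "ext_deriv 5 \<omega> = (\<lambda>p v. 0)"
proof -
  have alt: "alt_form 5 (\<omega> 0)"
    using \<omega> by (simp add: left_inv_form_def)
  have "lie_d heis_struct 5 (\<omega> 0) w = 0" for w
  proof (rule alt_form_eq_0_if_Basis[OF alt_form_lie_d[OF alt bilinear_heis_struct]])
    fix w :: "nat \<Rightarrow> complex^3" assume w: "w ` {..<Suc 5} \<subseteq> Basis" "inj_on w {..<Suc 5}"
    \<comment> \<open>Six distinct basis vectors exhaust the basis, the real dimension being
      6.\<close>
    have "w ` {..<Suc 5} = Basis"
      using w by (intro card_subset_eq) (auto simp: card_image)
    have "\<omega> 0 ((\<lambda>m. w (skip i m))(j := heis_struct (w i) (w (skip i j)))) = 0"
      if ij: "i \<le> 5" "j < 5" for i j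
    proof (cases "w i $ 1 = 0 \<or> w (skip i j) $ 2 = 0")
      case True
      then have "heis_struct (w i) (w (skip i j)) = 0"
        by (auto simp: heis_struct_def)
      then show ?thesis
        using linear_0[OF alt_form_linear[OF alt \<open>j < 5\<close>]] by simp
    next
      case False
      let ?u = "\<lambda>m. w (skip i m)"
      \<comment> \<open>The central vector \<open>axis 3 b\<close> is among the \<open>w n\<close>.
        It is neither \<open>w i\<close> nor \<open>w (skip i j)\<close>, whose first and second
        coordinates respectively are nonzero, so it still sits in a slot \<open>m\<close> other than
        \<open>j\<close>.\<close>
      have central: "\<omega> 0 (?u(j := axis 3 b)) = 0" if "b \<in> Basis" for b :: complex
      proof -
        have "axis 3 b \<in> w ` {..<Suc 5}"
          using that unfolding \<open>w ` _ = Basis\<close> by (simp add: axis_in_Basis_iff)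
        then obtain n where n: "n < Suc 5" "w n = axis 3 b"
          by auto
        then have ne: "n \<noteq> i" "n \<noteq> skip i j"
          using False by (auto simp: axis_def)
        define m where "m = (if n < i then n else n - 1)"
        have m: "m < 5" "skip i m = n"
          using n ne ij by (auto simp: m_def skip_def)
        then show ?thesis
          using n ne ij by (intro alt_form_eq_0[OF alt, of m j]) auto
      qed
      define c where "c = - (w i $ 1 * w (skip i j) $ 2)"
      have "heis_struct (w i) (w (skip i j)) = Re c *\<^sub>R axis 3 1 + Im c *\<^sub>R axis 3 \<i>"
        by (auto simp: vec_eq_iff forall_3 axis_def complex_eq_iff c_def)
      moreover have "\<omega> 0 (?u(j := Re c *\<^sub>R axis 3 1 + Im c *\<^sub>R axis 3 \<i>)) = 0"
        using linear_add[OF alt_form_linear[OF alt \<open>j < 5\<close>]] linear_scale[OF alt_form_linear[OF alt \<open>j < 5\<close>]]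
          central[of 1] central[of \<i>]
        by (simp add: Basis_complex_def)
      ultimately show ?thesis by simp
    qed
    then show "lie_d heis_struct 5 (\<omega> 0) w = 0"
      unfolding lie_d_def by (intro sum.neutral ballI) simp
  qed
  then show ?thesis
    by (intro ext) (simp add: ext_deriv_left_inv_form[OF \<omega>])
qed

lemma left_inv_form_delbar:
  assumes "left_inv_form k \<omega>"
  shows "left_inv_form (Suc k) (delbar iwasawa_J k \<omega>)"
proof -
  have "left_inv_form (Suc k)
      (bidegree_part iwasawa_J p (Suc (k - p)) (ext_deriv k (bidegree_part iwasawa_J p (k - p) \<omega>)))"
    if "p \<le> k" for p
  proof -
    have "left_inv_form k (bidegree_part iwasawa_J p (k - p) \<omega>)"
      using left_inv_form_bidegree_part[of p "k - p" \<omega>] assms that by simp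
    then show ?thesis
      using left_inv_form_bidegree_part[of p "Suc (k - p)"] left_inv_form_ext_deriv that by simp
  qed
  then show ?thesis
    using left_inv_form_sum[of "{..k}" "Suc k"] by (simp add: delbar_def[abs_def])
qed

text \<open>Each bidegree component of an invariant 5-form is itself invariant and hence closed, so
  every summand of \<open>del\<close> vanishes.\<close>

lemma del_left_inv_5_form:
  assumes "left_inv_form 5 \<omega>"
  shows "del iwasawa_J 5 \<omega> = (\<lambda>p v. 0)"
proof -
  have "ext_deriv 5 (bidegree_part iwasawa_J p (5 - p) \<omega>) = (\<lambda>p v. 0)" if "p \<le> 5" for p
    using left_inv_form_bidegree_part[of p "5 - p" \<omega>] assms that
    by (intro ext_deriv_left_inv_5_form) simp
  then show ?thesis
    by (intro ext) (simp add: del_def bidegree_part_def)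
qed

section \<open>The metrics \<open>\<omega>\<^sub>t\<^sup>1\<^sup>,\<^sup>1\<close>\<close>

text \<open>The mixed terms, with \<open>J\<close> in exactly one slot, cancel between
  \<open>S = {0}\<close> and \<open>S = {1}\<close>. What remains is the average of the form with
  its transform under \<open>J\<close>.\<close>

lemma bidegree_part_1_1:
  assumes \<omega>: "alt_form 2 (\<omega> p)"
  shows "bidegree_part J 1 1 \<omega> p v = (\<omega> p v + \<omega> p (\<lambda>i. J p (v i))) / 2"
proof -
  let ?S = "{S. S \<subseteq> {..<1 + 1} \<and> card S = 1} :: nat set set"
  define F where "F T = \<omega> p (\<lambda>j. if j \<in> T then J p (v j) else v j)" for T
  have lt2: "{..<1 + 1} = {0, 1::nat}" by auto
  have sum_S: "(\<Sum>S\<in>?S. g S) = g {0} + g {1}" for g :: "nat set \<Rightarrow> complex"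
  proof -
    have "?S = {{0}, {1}}"
      unfolding lt2 by (auto simp: card_1_singleton_iff)
    then show ?thesis by simp
  qed
  have sum_T: "(\<Sum>T\<in>Pow {..<1 + 1}. g T) = g {} + g {0} + g {1} + g {0, 1}"
    for g :: "nat set \<Rightarrow> complex"
  proof -
    have "Pow {..<1 + 1} = {{}, {0}, {1}, {0, 1::nat}}"
      unfolding lt2 by (auto simp: Pow_insert)
    moreover have "{0} \<noteq> {0, 1::nat}" "{1} \<noteq> {0, 1::nat}" by auto
    ultimately show ?thesis by (simp add: add.assoc)
  qed
  have F01: "F {0, 1} = \<omega> p (\<lambda>i. J p (v i))"
    unfolding F_def by (rule alt_form_cong[OF \<omega>]) auto
  have F0: "F {} = \<omega> p v"
    by (simp add: F_def)
  have "bidegree_part J 1 1 \<omega> p v =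
      (F {} - \<i> * F {0} + \<i> * F {1} + F {0, 1}) / 4 + (F {} + \<i> * F {0} - \<i> * F {1} + F {0, 1}) / 4"
    unfolding bidegree_part_def F_def[symmetric] sum_S sum_T by simp
  also have "\<dots> = (F {} + F {0, 1}) / 2"
    by (simp flip: add_divide_distrib)
  finally show ?thesis unfolding F01 F0 .
qed

section \<open>Explicit formula for the forms \<omega>_t\<close>

lemma alt_form_1I:
  assumes "\<And>v w. v 0 = w 0 \<Longrightarrow> f v = f w" "linear (\<lambda>x. f (\<lambda>_. x))"
  shows "alt_form 1 f"
proof (rule alt_formI)
  show "linear (\<lambda>x. f (v(i := x)))" if "i < 1" for v i
  proof -
    have "f (v(i := x)) = f (\<lambda>_. x)" for x
      using that by (intro assms(1)) auto
    then show ?thesis using assms(2) by simp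
  qed
next
  show "f v = f w" if "\<And>i. i < 1 \<Longrightarrow> v i = w i" for v w
    using that by (intro assms(1)) simp
qed auto

lemma wedge_1_1:
  assumes \<eta>: "alt_form 1 (\<eta> p)" and \<theta>: "alt_form 1 (\<theta> p)"
  shows "wedge 1 1 \<eta> \<theta> p v =
    \<eta> p (\<lambda>_. v 0) * \<theta> p (\<lambda>_. v 1) - \<eta> p (\<lambda>_. v 1) * \<theta> p (\<lambda>_. v 0)"
proof -
  let ?\<tau> = "Transposition.transpose 0 (1::nat)"
  have perms: "{\<sigma>. \<sigma> permutes {..<1 + 1}} = {id, ?\<tau>}"
    using permutes_doubleton_iff[of _ 0 "1::nat"] by (auto simp: lessThan_Suc insert_commute)
  have "id \<noteq> ?\<tau>"
    by (metis id_apply transpose_apply_first zero_neq_one)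
  then have sum: "(\<Sum>\<sigma>\<in>{id, ?\<tau>}. g \<sigma>) = g id + g ?\<tau>" for g :: "(nat \<Rightarrow> nat) \<Rightarrow> complex"
    by simp
  have \<eta>01: "\<eta> p (\<lambda>i. v (id i)) = \<eta> p (\<lambda>_. v 0)" "\<eta> p (\<lambda>i. v (?\<tau> i)) = \<eta> p (\<lambda>_. v 1)"
    by (rule alt_form_cong[OF \<eta>]; simp)+
  have \<theta>01: "\<theta> p (\<lambda>i. v (id (1 + i))) = \<theta> p (\<lambda>_. v 1)"
    "\<theta> p (\<lambda>i. v (?\<tau> (1 + i))) = \<theta> p (\<lambda>_. v 0)"
    by (rule alt_form_cong[OF \<theta>]; simp)+
  have signs: "sign (id :: nat \<Rightarrow> nat) = 1" "sign ?\<tau> = - 1"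
    by (simp_all add: sign_swap_id)
  show ?thesis
    unfolding wedge_def perms sum \<eta>01 \<theta>01 signs by simp
qed

text \<open>The value at (u, w) of i times the wedge of \<open>h\<close> with its conjugate.\<close>

definition herm_square :: "('a \<Rightarrow> complex) \<Rightarrow> 'a \<Rightarrow> 'a \<Rightarrow> complex" where
  "herm_square h u w = \<i> * (h u * cnj (h w) - h w * cnj (h u))"

lemma cnj_herm_square: "cnj (herm_square h u w) = herm_square h u w"
  by (simp add: herm_square_def algebra_simps)

text \<open>The value of \<open>kur_alpha\<close> at the identity. Here and in the next two
  definitions the bracket isolates the (0,1)-part, as the positivity proof requires.\<close>

definition kur_alpha0 :: "complex^2^3 \<Rightarrow> complex^3 \<Rightarrow> complex" where
  "kur_alpha0 t u = u $ 1 + (t $ 1 $ 1 * cnj (u $ 1) + t $ 1 $ 2 * cnj (u $ 2))"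

definition kur_beta0 :: "complex^2^3 \<Rightarrow> complex^3 \<Rightarrow> complex" where
  "kur_beta0 t u = u $ 2 + (t $ 2 $ 1 * cnj (u $ 1) + t $ 2 $ 2 * cnj (u $ 2))"

definition kur_gamma0 :: "complex^2^3 \<Rightarrow> complex^3 \<Rightarrow> complex" where
  "kur_gamma0 t u =
     u $ 3 + (t $ 3 $ 1 * cnj (u $ 1) + t $ 3 $ 2 * cnj (u $ 2) - kur_D t * cnj (u $ 3))"

definition kur_omega0 :: "complex^2^3 \<Rightarrow> complex^3 \<Rightarrow> complex^3 \<Rightarrow> complex" where
  "kur_omega0 t u w =
     herm_square (kur_alpha0 t) u w + herm_square (kur_beta0 t) u w + herm_square (kur_gamma0 t) u w"

lemma linear_kur_coframe:
  "linear (kur_alpha0 t)" "linear (kur_beta0 t)" "linear (kur_gamma0 t)"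
  unfolding linear_iff kur_alpha0_def kur_beta0_def kur_gamma0_def
  by (simp_all add: algebra_simps)

lemma alt_form_herm_square:
  assumes "linear h"
  shows "alt_form 2 (\<lambda>v. herm_square h (v 0) (v 1))"
proof (rule alt_formI)
  show "linear (\<lambda>x. herm_square h ((v(i := x)) 0) ((v(i := x)) 1))" if "i < 2" for v and i :: nat
  proof -
    have "i = 0 \<or> i = 1" using that by auto
    then show ?thesis
      using linear_add[OF assms] linear_scale[OF assms] unfolding linear_iff herm_square_def
      by (auto simp: algebra_simps scaleR_conv_of_real)
  qed
  show "herm_square h (v 0) (v 1) = 0" if "i < j" "j < 2" "v i = v j" for v and i j :: nat
  proof -
    have "i = 0" "j = 1" using that by auto
    with that show ?thesis by (simp add: herm_square_def)
  qed
qed auto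

text \<open>The coframe of X_t has constant coefficients in the left-invariant forms \<alpha>,
  \<beta>, \<gamma> and their conjugates, so the point enters only through the
  trivialisation.\<close>

lemma kur_omega_eq:
  "kur_omega t p v = kur_omega0 t (heis_triv p (v 0)) (heis_triv p (v 1))"
proof -
  have forms: "kur_alpha t p = (\<lambda>v. kur_alpha0 t (heis_triv p (v 0)))"
    "kur_beta t p = (\<lambda>v. kur_beta0 t (heis_triv p (v 0)))"
    "kur_gamma t p = (\<lambda>v. kur_gamma0 t (heis_triv p (v 0)))" for p
    by (rule ext; simp add: kur_alpha_def kur_beta_def kur_gamma_def kur_alpha0_def kur_beta0_def
        kur_gamma0_def iw_alpha_def iw_beta_def iw_gamma_def cnj_form_def)+
  have wedge: "\<i> * wedge 1 1 \<eta> (cnj_form \<eta>) p v = herm_square h (heis_triv p (v 0)) (heis_triv p (v 1))"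
    if "\<eta> p = (\<lambda>v. h (heis_triv p (v 0)))" "linear h" for \<eta> :: "3 form" and h
  proof -
    have lin: "linear (\<lambda>x. h (heis_triv p x))"
      using linear_compose[OF linear_heis_triv that(2)] by (simp add: o_def)
    have cnj_lin: "linear (\<lambda>x. cnj (h (heis_triv p x)))"
      using linear_add[OF lin] linear_scale[OF lin] by (intro linearI) simp_all
    have "alt_form 1 (\<eta> p)"
      unfolding that(1) by (rule alt_form_1I) (simp_all add: lin)
    moreover have "alt_form 1 (cnj_form \<eta> p)"
      unfolding cnj_form_def[abs_def] that(1) by (rule alt_form_1I) (simp_all add: cnj_lin)
    ultimately show ?thesis
      using that by (subst wedge_1_1) (simp_all add: cnj_form_def herm_square_def)
  qed
  show ?thesis
    unfolding kur_omega_def kur_omega0_def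
    by (simp only: wedge[of "kur_alpha t" "kur_alpha0 t", OF forms(1) linear_kur_coframe(1)]
        wedge[of "kur_beta t" "kur_beta0 t", OF forms(2) linear_kur_coframe(2)]
        wedge[of "kur_gamma t" "kur_gamma0 t", OF forms(3) linear_kur_coframe(3)])
qed

lemma alt_form_add: "alt_form k f \<Longrightarrow> alt_form k g \<Longrightarrow> alt_form k (\<lambda>v. f v + g v)"
  using alt_form_sum[of UNIV k "\<lambda>b. if b then f else g"] by (simp add: UNIV_bool add.commute)

lemma left_inv_form_kur_omega: "left_inv_form 2 (kur_omega t)"
  using linear_kur_coframe unfolding left_inv_form_def
  by (simp add: kur_omega_eq[abs_def] kur_omega0_def alt_form_add alt_form_herm_square[simplified])

section \<open>The component of bidegree (1,1) of \<omega>_t\<close>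

definition kur_metric :: "complex^2^3 \<Rightarrow> 3 form" where
  "kur_metric t = bidegree_part iwasawa_J 1 1 (kur_omega t)"

lemma kur_metric_eq: "kur_metric t p v = (kur_omega t p v + kur_omega t p (\<lambda>i. iwasawa_J p (v i))) / 2"
  unfolding kur_metric_def by (intro bidegree_part_1_1 alt_form_left_inv_form left_inv_form_kur_omega)

lemma left_inv_form_kur_metric: "left_inv_form 2 (kur_metric t)"
  using left_inv_form_bidegree_part[of 1 1 "kur_omega t"] left_inv_form_kur_omega
  by (simp add: kur_metric_def numeral_2_eq_2)

text \<open>Applying \<open>iwasawa_J\<close> twice gives -1, which acts trivially on 2-forms. The
  average is therefore invariant under \<open>iwasawa_J\<close>, and averaging again does not change
  it.\<close>

lemma has_bidegree_kur_metric: "has_bidegree iwasawa_J 1 1 (kur_metric t)"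
proof -
  have "herm_square h (- u) (- w) = herm_square h u w" if "linear h" for h :: "complex^3 \<Rightarrow> complex" and u w
    using linear_neg[OF that] by (simp add: herm_square_def)
  then have "kur_omega t p (\<lambda>i. - v i) = kur_omega t p v" for p v
    using linear_kur_coframe by (simp add: kur_omega_eq kur_omega0_def linear_neg[OF linear_heis_triv])
  then have "kur_metric t p (\<lambda>i. iwasawa_J p (v i)) = kur_metric t p v" for p v
    by (simp add: kur_metric_eq)
  then show ?thesis
    unfolding has_bidegree_def fun_eq_iff
    by (subst bidegree_part_1_1[OF alt_form_left_inv_form[OF left_inv_form_kur_metric]]) simp
qed

lemma herm_square_times_i:
  assumes "h u' = \<i> * h u" "h w' = \<i> * h w"
  shows "herm_square h u' w' = herm_square h u w"
  unfolding herm_square_def assms by (simp add: complex_eq_iff algebra_simps)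

text \<open>At \<open>t = 0\<close> the coframe is complex-linear, so each square is already
  invariant under \<open>iwasawa_J\<close>.\<close>

lemma kur_metric_0: "kur_metric 0 = kur_omega 0"
proof -
  have "kur_omega0 0 (iwasawa_J 0 u) (iwasawa_J 0 w) = kur_omega0 0 u w" for u w
    unfolding kur_omega0_def
    by (subst (1 2 3) herm_square_times_i[of _ "iwasawa_J 0 u" u "iwasawa_J 0 w" w])
      (simp_all add: kur_alpha0_def kur_beta0_def kur_gamma0_def kur_D_def)
  then show ?thesis
    by (intro ext) (simp add: kur_metric_eq kur_omega_eq heis_triv_iwasawa_J)
qed

section \<open>Invariance under the lattice and smooth dependence on the parameter\<close>

lemma heis_nth [simp]:
  "heis a $ 1 $ 1 = 1" "heis a $ 1 $ 2 = a $ 1" "heis a $ 1 $ 3 = a $ 3"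
  "heis a $ 2 $ 1 = 0" "heis a $ 2 $ 2 = 1" "heis a $ 2 $ 3 = a $ 2"
  "heis a $ 3 $ 1 = 0" "heis a $ 3 $ 2 = 0" "heis a $ 3 $ 3 = 1"
  by (simp_all add: heis_def)

lemma left_translation_heis: "left_translation (heis a) z = a + heis_triv (- a) z"
  by (simp add: left_translation_def heis_coords_def matrix_matrix_mult_def vec_eq_iff forall_3 sum_3)

lemma pullback_left_translation_left_inv_form:
  assumes \<omega>: "left_inv_form k \<omega>"
  shows "pullback (left_translation (heis a)) \<omega> = \<omega>"
proof (intro ext)
  fix p v
  have "bounded_linear (heis_triv (- a))"
    using linear_heis_triv by (simp add: linear_conv_bounded_linear)
  then have "((\<lambda>z. a + heis_triv (- a) z) has_derivative (\<lambda>h. 0 + heis_triv (- a) h)) (at p)"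
    by (intro has_derivative_add has_derivative_const bounded_linear_imp_has_derivative)
  then have "frechet_derivative (left_translation (heis a)) (at p) u = heis_triv (- a) u" for u
    by (subst frechet_derivative_eq) (auto simp: left_translation_heis[abs_def])
  \<comment> \<open>Chain rule for translations: moving from \<open>p\<close> by
    \<open>heis a\<close> and then to the identity has the same differential as moving directly from
    \<open>p\<close> to the identity.\<close>
  moreover have "heis_triv (a + heis_triv (- a) p) (heis_triv (- a) u) = heis_triv p u" for u
    by (simp add: vec_eq_iff forall_3 algebra_simps)
  ultimately show "pullback (left_translation (heis a)) \<omega> p v = \<omega> p v"
    unfolding pullback_def left_inv_formD[OF \<omega>, of p] left_inv_formD[OF \<omega>, of "left_translation _ p"]
    by (simp add: left_translation_heis)
qed

text \<open>For fixed \<open>v\<close> the value is polynomial in the t_ij, the coordinate z_1 and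
  their conjugates. Letting \<open>t\<close> and \<open>p\<close> depend on a common variable covers
  both joint smoothness and smoothness for a fixed parameter.\<close>

lemma smooth_on_kur_metric:
  assumes S: "open S" and t: "\<And>i j. smooth_on (\<lambda>x. t x $ i $ j) S"
    and p: "smooth_on (\<lambda>x. p x $ 1) S"
  shows "smooth_on (\<lambda>x. kur_metric (t x) (p x) v) S"
  unfolding kur_metric_eq kur_omega_eq kur_omega0_def herm_square_def kur_alpha0_def kur_beta0_def
    kur_gamma0_def kur_D_def heis_triv_nth iwasawa_J_nth divide_inverse
  by (intro smooth_intros S t p)

lemma smooth_family_on_kur_metric:
  assumes "open \<Delta>"
  shows "smooth_family_on \<Delta> kur_metric"
  unfolding smooth_family_on_def case_prod_beta
proof (intro allI smooth_on_kur_metric)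
  show "open (\<Delta> \<times> UNIV)"
    using assms by (simp add: open_Times)
  then show "smooth_on (\<lambda>x. fst x $ i $ j) (\<Delta> \<times> UNIV)" for i j
    by (rule smooth_on_linear[OF _ bounded_linear_compose[OF bounded_linear_vec_nth
            bounded_linear_compose[OF bounded_linear_vec_nth bounded_linear_fst]]])
  from \<open>open (\<Delta> \<times> UNIV)\<close> show "smooth_on (\<lambda>x. snd x $ 1) (\<Delta> \<times> UNIV)"
    by (rule smooth_on_linear[OF _ bounded_linear_compose[OF bounded_linear_vec_nth bounded_linear_snd]])
qed

lemma iwasawa_form_kur_metric: "iwasawa_form 2 (kur_metric t)"
proof -
  have "smooth_on (\<lambda>p. kur_metric t p v) UNIV" for v
    by (intro smooth_on_kur_metric smooth_on_const smooth_on_linear bounded_linear_vec_nth) simp_all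
  then show ?thesis
    using alt_form_left_inv_form[OF left_inv_form_kur_metric]
      pullback_left_translation_left_inv_form[OF left_inv_form_kur_metric]
    by (auto simp: iwasawa_form_def diff_form_iff_alt_form heis_lattice_def)
qed

section \<open>Reality and positivity\<close>

lemma kur_metric_real: "kur_metric t p v \<in> \<real>"
  by (simp add: Reals_cnj_iff kur_metric_eq kur_omega_eq kur_omega0_def cnj_herm_square)

text \<open>Here \<open>a\<close> and \<open>b\<close> are the (1,0)- and (0,1)-parts of
  \<open>h\<close> at \<open>u\<close>; passing from \<open>u\<close> to its image \<open>w\<close>
  under the complex structure multiplies them by \<open>\<i>\<close> and
  \<open>- \<i>\<close>.\<close>

lemma herm_square_add_diff:
  assumes "h u = a + b" "h w = \<i> * a - \<i> * b"
  shows "herm_square h u w = of_real (2 * ((cmod a)\<^sup>2 - (cmod b)\<^sup>2))"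
  unfolding herm_square_def assms cmod_power2
  by (simp add: complex_eq_iff algebra_simps power2_eq_square)

lemma kur_metric_pos:
  assumes t: "norm t < 1/4" and u: "u \<noteq> 0"
  shows "0 < Re (kur_metric t p (\<lambda>i. if i = 0 then u else iwasawa_J p u))"
proof -
  define z where "z = heis_triv p u"
  define s where "s = cmod (z $ 1) + cmod (z $ 2) + cmod (z $ 3)"
  define b1 where "b1 = t $ 1 $ 1 * cnj (z $ 1) + t $ 1 $ 2 * cnj (z $ 2)"
  define b2 where "b2 = t $ 2 $ 1 * cnj (z $ 1) + t $ 2 $ 2 * cnj (z $ 2)"
  define b3 where "b3 = t $ 3 $ 1 * cnj (z $ 1) + t $ 3 $ 2 * cnj (z $ 2) - kur_D t * cnj (z $ 3)"
  have t_le: "cmod (t $ i $ j) \<le> 1/4" for i j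
    using t Finite_Cartesian_Product.norm_nth_le[of t i] Finite_Cartesian_Product.norm_nth_le[of "t $ i" j]
    by linarith
  have term_le: "cmod (t $ i $ j * cnj y) \<le> 1/4 * cmod y" for i j y
    unfolding norm_mult complex_mod_cnj by (intro mult_right_mono t_le) simp
  \<comment> \<open>The bound is 1/8, so \<open>kur_D t\<close> also obeys the bound 1/4 of the
    coordinates of \<open>t\<close>.\<close>
  have "cmod (kur_D t) \<le> 1/4 * (1/4) + 1/4 * (1/4)"
    unfolding kur_D_def
    by (intro order.trans[OF norm_triangle_ineq4] add_mono) (auto simp only: norm_mult intro!: mult_mono t_le norm_ge_zero)
  then have D_le: "cmod (kur_D t * cnj y) \<le> 1/4 * cmod y" for y
    unfolding norm_mult complex_mod_cnj by (intro mult_right_mono) auto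
  have b12: "cmod b1 \<le> s / 4" "cmod b2 \<le> s / 4"
    unfolding b1_def b2_def
    by (rule norm_triangle_le[OF order.trans[OF add_mono[OF term_le term_le]]]; simp add: s_def)+
  have "cmod b3 \<le> s / 4"
    unfolding b3_def
    by (rule norm_triangle_le_diff[OF order.trans[OF add_mono[OF norm_triangle_le[OF add_mono[OF term_le term_le]] D_le]]])
      (simp add: s_def)
  with b12 have "(cmod b1)\<^sup>2 + (cmod b2)\<^sup>2 + (cmod b3)\<^sup>2 \<le> (s / 4)\<^sup>2 + (s / 4)\<^sup>2 + (s / 4)\<^sup>2"
    by (intro add_mono power_mono) auto
  also have "\<dots> = 3/16 * s\<^sup>2"
    by (simp add: power2_eq_square)
  \<comment> \<open>Cauchy-Schwarz for three terms costs a factor 3. The resulting 9/16 is below 1,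
    which is why the radius 1/4 suffices.\<close>
  also have "\<dots> \<le> 9/16 * ((cmod (z $ 1))\<^sup>2 + (cmod (z $ 2))\<^sup>2 + (cmod (z $ 3))\<^sup>2)"
  proof -
    have "s\<^sup>2 \<le> 3 * (x\<^sup>2 + y\<^sup>2 + w\<^sup>2)" if "s = x + y + w" for x y w
    proof -
      have "0 \<le> (x - y)\<^sup>2 + (y - w)\<^sup>2 + (x - w)\<^sup>2" by simp
      also have "\<dots> = 3 * (x\<^sup>2 + y\<^sup>2 + w\<^sup>2) - s\<^sup>2"
        unfolding that by (simp add: power2_eq_square algebra_simps)
      finally show ?thesis by simp
    qed
    from this[OF s_def] show ?thesis by simp
  qed
  also have "\<dots> < (cmod (z $ 1))\<^sup>2 + (cmod (z $ 2))\<^sup>2 + (cmod (z $ 3))\<^sup>2"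
  proof -
    have "z $ 1 \<noteq> 0 \<or> z $ 2 \<noteq> 0 \<or> z $ 3 \<noteq> 0"
      using u by (auto simp: z_def vec_eq_iff forall_3)
    then have "0 < (cmod (z $ 1))\<^sup>2 + (cmod (z $ 2))\<^sup>2 + (cmod (z $ 3))\<^sup>2"
      by (auto simp: add_pos_nonneg add_nonneg_pos)
    then show ?thesis by simp
  qed
  finally have less: "(cmod b1)\<^sup>2 + (cmod b2)\<^sup>2 + (cmod b3)\<^sup>2 <
    (cmod (z $ 1))\<^sup>2 + (cmod (z $ 2))\<^sup>2 + (cmod (z $ 3))\<^sup>2" .
  let ?Q = "2 * ((cmod (z $ 1))\<^sup>2 - (cmod b1)\<^sup>2) + 2 * ((cmod (z $ 2))\<^sup>2 - (cmod b2)\<^sup>2) +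
    2 * ((cmod (z $ 3))\<^sup>2 - (cmod b3)\<^sup>2)"
  \<comment> \<open>The second half of the average is evaluated at the images of z and
    \<open>iwasawa_J 0 z\<close>; by skew-symmetry it equals the first half.\<close>
  have hs: "herm_square h (iwasawa_J 0 y) (- y) = herm_square h y (iwasawa_J 0 y)"
    if "linear h" for h :: "complex^3 \<Rightarrow> complex" and y
    using linear_neg[OF that] by (simp add: herm_square_def)
  have "kur_metric t p (\<lambda>i. if i = 0 then u else iwasawa_J p u) = kur_omega0 t z (iwasawa_J 0 z)"
    using linear_kur_coframe
    by (simp add: kur_metric_eq kur_omega_eq heis_triv_iwasawa_J linear_neg[OF linear_heis_triv]
        kur_omega0_def hs flip: z_def)
  also have "\<dots> = of_real ?Q"
  proof -
    have "herm_square (kur_alpha0 t) z (iwasawa_J 0 z) = of_real (2 * ((cmod (z $ 1))\<^sup>2 - (cmod b1)\<^sup>2))"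
      by (rule herm_square_add_diff) (simp_all add: kur_alpha0_def b1_def algebra_simps)
    moreover have "herm_square (kur_beta0 t) z (iwasawa_J 0 z) = of_real (2 * ((cmod (z $ 2))\<^sup>2 - (cmod b2)\<^sup>2))"
      by (rule herm_square_add_diff) (simp_all add: kur_beta0_def b2_def algebra_simps)
    moreover have "herm_square (kur_gamma0 t) z (iwasawa_J 0 z) = of_real (2 * ((cmod (z $ 3))\<^sup>2 - (cmod b3)\<^sup>2))"
      by (rule herm_square_add_diff) (simp_all add: kur_gamma0_def b3_def algebra_simps)
    ultimately show ?thesis by (simp add: kur_omega0_def)
  qed
  finally show ?thesis using less by simp
qed

text \<open>The bound on \<open>t\<close> provides positivity; the Gauduchon equation comes from
  invariance, with degrees 4 and 5 because n = 3.\<close>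

lemma gauduchon_metric_kur_metric:
  assumes "norm t < 1/4"
  shows "gauduchon_metric iwasawa_J (kur_metric t)"
proof -
  have "left_inv_form 4 (wedge_power 2 (kur_metric t) 2)"
    using left_inv_form_wedge_power[OF left_inv_form_kur_metric, of 2 t] by simp
  then have "left_inv_form 5 (delbar iwasawa_J 4 (wedge_power 2 (kur_metric t) 2))"
    using left_inv_form_delbar[of 4] by simp
  then show ?thesis
    using iwasawa_form_kur_metric has_bidegree_kur_metric kur_metric_real kur_metric_pos[OF assms]
    by (simp add: gauduchon_metric_def hermitian_metric_def del_left_inv_5_form)
qed

theorem proposition6p2:
  fixes \<Delta> :: "(complex^2^3) set" and J :: "complex^2^3 \<Rightarrow> 3 acs"
  assumes "iwasawa_kuranishi_family \<Delta> J"
  shows "(\<exists>\<epsilon>>0. \<forall>t\<in>\<Delta>. norm t < \<epsilon> \<longrightarrow>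
            gauduchon_metric (J 0) (bidegree_part (J 0) 1 1 (kur_omega t))) \<and>
         bidegree_part (J 0) 1 1 (kur_omega 0) = kur_omega 0 \<and>
         smooth_family_on \<Delta> (\<lambda>t. bidegree_part (J 0) 1 1 (kur_omega t))"
proof -
  have J: "J 0 = iwasawa_J" and "open \<Delta>"
    using assms by (auto simp: iwasawa_kuranishi_family_def)
  show ?thesis
    unfolding J kur_metric_def[symmetric]
  \<comment> \<open>The witness 1/4 is the radius on which positivity was established.\<close>
  proof (intro conjI exI[of _ "1/4 :: real"] ballI impI)
    show "smooth_family_on \<Delta> kur_metric"
      using \<open>open \<Delta>\<close> by (rule smooth_family_on_kur_metric)
  qed (simp_all add: gauduchon_metric_kur_metric kur_metric_0)
qed

end
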